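(* Let $N\ge 1$ and finite weights $C_0,C_1,C_2,C_3\ge 0$ be given. Consider the optimal stopping problem $$\min_{\Psi}\ \sum_{n=0}^N \mathbf{E}\big[\Phi_n\,(n+g(\mathbf{t}_n))\big],\qquad g(\mathbf{t}_n)=\min\{D^\star_{0,n}(\mathbf{t}_n),D^\star_{1,n}(\mathbf{t}_n)\},$$ over all non-randomized stopping rules $\Psi=(\Psi_n)_{0\le n\le N}$ truncated at $N$ (i.e. $\Psi_N=1$). The solution of this problem can be characterized by the system of functional equations $$\rho_n(\mathbf{t}_n)=\min\{g(\mathbf{t}_n),\,d_n(\mathbf{t}_n)\}\quad (n<N),\qquad \rho_N(\mathbf{t}_N)=g(\mathbf{t}_N),$$ where $$d_n(\mathbf{t}_n)=1+\int \rho_{n+1}\big(\xi(\mathbf{t}_n,\tilde x)\big)\,p(\tilde x\mid \mathbf{t}_n)\,\mathrm{d}\tilde x .$$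
   Context: Model. A hypothesis $\mathrm{H}\in\{\mathrm{H}_0,\mathrm{H}_1\}$ is drawn with prior probabilities $p(\mathrm{H}_0),p(\mathrm{H}_1)$; given $\mathrm{H}_i$, a real random parameter $\Theta$ is drawn with density $p(\theta\mid \mathrm{H}_i)$; given $\Theta=\theta$, the observations $X_1,\dots,X_N$ (values in a state space $E_X$) are i.i.d. with density $p(x\mid\theta)$. Thus $p(\mathrm{H}_i,\theta,x_1,\dots,x_N)=\prod_{n=1}^N p(x_n\mid\theta)\,p(\theta\mid\mathrm{H}_i)\,p(\mathrm{H}_i)$. The hypothesis and parameter do not change during observation. Write $\boldsymbol{x}_n=(x_1,\dots,x_n)$. Standing assumptions. $\mathbf{E}[\Theta^2]<\infty$. The hypotheses are separable: for some $i\in\{0,1\}$, $\lim_{N\to\infty}p(\mathrm{H}_i\mid\boldsymbol{x}_N)=1$. There is a sufficient statistic $\mathbf{t}_n=\mathbf{t}_n(\boldsymbol{x}_n)$ in a state space $E_{\mathbf t}$ with $p(\theta\mid\boldsymbol{x}_n)=p(\theta\mid\mathbf{t}_n)$, satisfying $\mathbf{t}_{n+1}=\xi(\mathbf{t}_n,x_{n+1})$ with some initial value $\mathbf{t}_0$; in all conditional probabilities and expectations, conditioning on $\boldsymbol{x}_n$ is replaced by conditioning on $\mathbf{t}_n$. $p(\tilde x\mid\mathbf{t}_n)$ is the conditional density of $X_{n+1}$ given $\mathbf{t}_n$. Stopping rules. A non-randomized stopping rule is $\Psi=(\Psi_n)_{0\le n\le N}$ with $\Psi_n=\Psi_n(\boldsymbol{x}_n)\in\{0,1\}$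 ($1$ = stop). The stopping time is $\tau=\inf\{n:\Psi_n=1\}$ and $\Phi_n=\Psi_n\prod_{i=0}^{n-1}(1-\Psi_i)=\mathbf{1}_{\{\tau=n\}}$. Costs. For $i\in\{0,1\}$, $D^\star_{i,n}(\mathbf{t}_n)=C_{1-i}\,p(\mathrm{H}_{1-i}\mid\mathbf{t}_n)+C_{2+i}\,p(\mathrm{H}_i\mid\mathbf{t}_n)\,\mathbf{Var}[\Theta\mid\mathbf{t}_n,\mathrm{H}_i]$. *)

theory Defs
  imports "HOL-Probability.Probability"
begin

text \<open>
  \<open>q z y\<close> is a version of the conditional density \<open>p(y | z)\<close> of \<open>Y\<close> given \<open>Z\<close>, with respect to the
  reference measure \<open>B\<close>: the joint law of \<open>(Z, Y)\<close> is \<open>p(y | z) P\<^sub>Z(dz) B(dy)\<close>.  As usual, a version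
  is determined only up to a null set of the law of \<open>Z\<close>.
\<close>
definition cond_density ::
  "'w measure \<Rightarrow> 'a measure \<Rightarrow> ('w \<Rightarrow> 'a) \<Rightarrow> 'b measure \<Rightarrow> ('w \<Rightarrow> 'b) \<Rightarrow> ('a \<Rightarrow> 'b \<Rightarrow> real) \<Rightarrow> bool"
  where
  "cond_density M A Z B Y q \<longleftrightarrow>
     Z \<in> measurable M A \<and>
     (\<forall>z\<in>space A. \<forall>y\<in>space B. 0 \<le> q z y) \<and>
     (\<lambda>(z, y). q z y) \<in> borel_measurable (A \<Otimes>\<^sub>M B) \<and>
     distributed M (distr M A Z \<Otimes>\<^sub>M B) (\<lambda>\<omega>. (Z \<omega>, Y \<omega>)) (\<lambda>(z, y). ennreal (q z y))"

text \<open>Observation histories \<open>x\<^sub>1, \<dots>, x\<^sub>n\<close> are points of \<open>\<Pi>\<^sub>M k\<in>{1..n}. \<mu>\<close>.\<close>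
definition obs :: "(nat \<Rightarrow> 'w \<Rightarrow> 'x) \<Rightarrow> nat \<Rightarrow> 'w \<Rightarrow> nat \<Rightarrow> 'x" where
  "obs X n \<omega> = (\<lambda>k\<in>{1..n}. X k \<omega>)"

primrec stat :: "'t \<Rightarrow> ('t \<Rightarrow> 'x \<Rightarrow> 't) \<Rightarrow> nat \<Rightarrow> (nat \<Rightarrow> 'x) \<Rightarrow> 't" where
  "stat t0 \<xi> 0 x = t0"
| "stat t0 \<xi> (Suc n) x = \<xi> (stat t0 \<xi> n x) (x (Suc n))"

text \<open>
  \<open>p\<^sub>H i = p(H\<^sub>i)\<close>, \<open>p\<^sub>\<Theta> i \<theta> = p(\<theta> | H\<^sub>i)\<close> and \<open>p\<^sub>X \<theta> x = p(x | \<theta>)\<close> specify the model.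
  The remaining parameters are versions of the conditional densities given the statistic:
  \<open>pH_t n t i = p(H\<^sub>i | t\<^sub>n = t)\<close>, \<open>p\<Theta>_t n t \<theta> = p(\<theta> | t\<^sub>n = t)\<close>,
  \<open>p\<Theta>_Ht n i t \<theta> = p(\<theta> | t\<^sub>n = t, H\<^sub>i)\<close> and \<open>pX_t n t x = p(x | t\<^sub>n = t)\<close>, the density of \<open>X\<^sub>n\<^sub>+\<^sub>1\<close>.
  The measure \<open>\<mu>\<close> is the reference measure on \<open>E\<^sub>X\<close>; of \<open>St\<close> only the measurable space \<open>E\<^sub>t\<close> matters.
\<close>
locale joint_detection_estimation =
  prob_space M + \<mu>: sigma_finite_measure \<mu>
  for M :: "'w measure" and \<mu> :: "'x measure" +
  fixes H :: "'w \<Rightarrow> nat" and \<Theta> :: "'w \<Rightarrow> real" and X :: "nat \<Rightarrow> 'w \<Rightarrow> 'x"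
    and p\<^sub>H :: "nat \<Rightarrow> real" and p\<^sub>\<Theta> :: "nat \<Rightarrow> real \<Rightarrow> real" and p\<^sub>X :: "real \<Rightarrow> 'x \<Rightarrow> real"
    and St :: "'t measure" and t0 :: 't and \<xi> :: "'t \<Rightarrow> 'x \<Rightarrow> 't"
    and pH_t :: "nat \<Rightarrow> 't \<Rightarrow> nat \<Rightarrow> real"
    and p\<Theta>_t :: "nat \<Rightarrow> 't \<Rightarrow> real \<Rightarrow> real"
    and p\<Theta>_Ht :: "nat \<Rightarrow> nat \<Rightarrow> 't \<Rightarrow> real \<Rightarrow> real"
    and pX_t :: "nat \<Rightarrow> 't \<Rightarrow> 'x \<Rightarrow> real"
  assumes prior: "0 \<le> p\<^sub>H 0" "0 \<le> p\<^sub>H 1" "p\<^sub>H 0 + p\<^sub>H 1 = 1"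
    and p\<Theta>_density: "\<And>i. i \<in> {0, 1} \<Longrightarrow>
          p\<^sub>\<Theta> i \<in> borel_measurable lborel \<and> (\<forall>\<theta>. 0 \<le> p\<^sub>\<Theta> i \<theta>) \<and> (\<integral>\<^sup>+\<theta>. ennreal (p\<^sub>\<Theta> i \<theta>) \<partial>lborel) = 1"
    and pX_measurable: "(\<lambda>(\<theta>, x). p\<^sub>X \<theta> x) \<in> borel_measurable (lborel \<Otimes>\<^sub>M \<mu>)"
    and pX_density: "\<And>\<theta>. (\<forall>x\<in>space \<mu>. 0 \<le> p\<^sub>X \<theta> x) \<and> (\<integral>\<^sup>+x. ennreal (p\<^sub>X \<theta> x) \<partial>\<mu>) = 1"
    and joint_density: "\<And>n. distributed M
          (count_space {0, 1} \<Otimes>\<^sub>M lborel \<Otimes>\<^sub>M (\<Pi>\<^sub>M k\<in>{1..n}. \<mu>))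
          (\<lambda>\<omega>. (H \<omega>, \<Theta> \<omega>, obs X n \<omega>))
          (\<lambda>(i, \<theta>, x). ennreal ((\<Prod>k\<in>{1..n}. p\<^sub>X \<theta> (x k)) * p\<^sub>\<Theta> i \<theta> * p\<^sub>H i))"
    and second_moment: "integrable M (\<lambda>\<omega>. (\<Theta> \<omega>)\<^sup>2)"
    and separable: "AE \<omega> in M. \<exists>i\<in>{0, 1}.
          (\<lambda>n. real_cond_exp M (vimage_algebra (space M) (obs X n) (\<Pi>\<^sub>M k\<in>{1..n}. \<mu>))
                 (indicator {\<omega>' \<in> space M. H \<omega>' = i}) \<omega>) \<longlonglongrightarrow> 1"
    and t0_in: "t0 \<in> space St"
    and \<xi>_measurable: "(\<lambda>(t, x). \<xi> t x) \<in> measurable (St \<Otimes>\<^sub>M \<mu>) St"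
    and p\<Theta>_t: "\<And>n. cond_density M St (\<lambda>\<omega>. stat t0 \<xi> n (obs X n \<omega>)) lborel \<Theta> (p\<Theta>_t n)"
    and sufficient: "\<And>n. cond_density M (\<Pi>\<^sub>M k\<in>{1..n}. \<mu>) (obs X n) lborel \<Theta>
          (\<lambda>x. p\<Theta>_t n (stat t0 \<xi> n x))"
    and pH_t: "\<And>n. cond_density M St (\<lambda>\<omega>. stat t0 \<xi> n (obs X n \<omega>)) (count_space {0, 1}) H (pH_t n)"
    and p\<Theta>_Ht: "\<And>n. cond_density M (count_space {0, 1} \<Otimes>\<^sub>M St)
          (\<lambda>\<omega>. (H \<omega>, stat t0 \<xi> n (obs X n \<omega>))) lborel \<Theta> (\<lambda>(i, t). p\<Theta>_Ht n i t)"
    and pX_t: "\<And>n. cond_density M St (\<lambda>\<omega>. stat t0 \<xi> n (obs X n \<omega>)) \<mu> (X (Suc n)) (pX_t n)"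

definition density_variance :: "(real \<Rightarrow> real) \<Rightarrow> real" where
  "density_variance q =
     (\<integral>\<theta>. (\<theta> - (\<integral>\<theta>'. \<theta>' * q \<theta>' \<partial>lborel))\<^sup>2 * q \<theta> \<partial>lborel)"

definition Dstar ::
  "(nat \<Rightarrow> real) \<Rightarrow> (nat \<Rightarrow> 't \<Rightarrow> nat \<Rightarrow> real) \<Rightarrow> (nat \<Rightarrow> nat \<Rightarrow> 't \<Rightarrow> real \<Rightarrow> real) \<Rightarrow>
   nat \<Rightarrow> nat \<Rightarrow> 't \<Rightarrow> real" where
  "Dstar C pH_t p\<Theta>_Ht i n t =
     C (1 - i) * pH_t n t (1 - i) + C (2 + i) * pH_t n t i * density_variance (p\<Theta>_Ht n i t)"

definition stop_cost ::
  "(nat \<Rightarrow> real) \<Rightarrow> (nat \<Rightarrow> 't \<Rightarrow> nat \<Rightarrow> real) \<Rightarrow> (nat \<Rightarrow> nat \<Rightarrow> 't \<Rightarrow> real \<Rightarrow> real) \<Rightarrow>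
   nat \<Rightarrow> 't \<Rightarrow> real" where
  "stop_cost C pH_t p\<Theta>_Ht n t = min (Dstar C pH_t p\<Theta>_Ht 0 n t) (Dstar C pH_t p\<Theta>_Ht 1 n t)"

definition stopping_rule :: "'x measure \<Rightarrow> nat \<Rightarrow> (nat \<Rightarrow> (nat \<Rightarrow> 'x) \<Rightarrow> nat) \<Rightarrow> bool" where
  "stopping_rule \<mu> N \<Psi> \<longleftrightarrow>
     (\<forall>n\<le>N. \<Psi> n \<in> measurable (\<Pi>\<^sub>M k\<in>{1..n}. \<mu>) (count_space {0, 1})) \<and>
     (\<forall>x\<in>space (\<Pi>\<^sub>M k\<in>{1..N}. \<mu>). \<Psi> N x = 1)"

definition stop_at ::
  "(nat \<Rightarrow> 'w \<Rightarrow> 'x) \<Rightarrow> (nat \<Rightarrow> (nat \<Rightarrow> 'x) \<Rightarrow> nat) \<Rightarrow> nat \<Rightarrow> 'w \<Rightarrow> real" where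
  "stop_at X \<Psi> n \<omega> = real (\<Psi> n (obs X n \<omega>)) * (\<Prod>i<n. 1 - real (\<Psi> i (obs X i \<omega>)))"

definition stopping_objective ::
  "'w measure \<Rightarrow> (nat \<Rightarrow> 'w \<Rightarrow> 'x) \<Rightarrow> 't \<Rightarrow> ('t \<Rightarrow> 'x \<Rightarrow> 't) \<Rightarrow> (nat \<Rightarrow> 't \<Rightarrow> real) \<Rightarrow> nat \<Rightarrow>
   (nat \<Rightarrow> (nat \<Rightarrow> 'x) \<Rightarrow> nat) \<Rightarrow> real" where
  "stopping_objective M X t0 \<xi> g N \<Psi> =
     (\<Sum>n\<le>N. \<integral>\<omega>. stop_at X \<Psi> n \<omega> * (real n + g n (stat t0 \<xi> n (obs X n \<omega>))) \<partial>M)"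

definition continuation_cost ::
  "'x measure \<Rightarrow> ('t \<Rightarrow> 'x \<Rightarrow> 't) \<Rightarrow> (nat \<Rightarrow> 't \<Rightarrow> 'x \<Rightarrow> real) \<Rightarrow> (nat \<Rightarrow> 't \<Rightarrow> real) \<Rightarrow>
   nat \<Rightarrow> 't \<Rightarrow> real" where
  "continuation_cost \<mu> \<xi> pX_t \<rho> n t = 1 + (\<integral>x. \<rho> (Suc n) (\<xi> t x) * pX_t n t x \<partial>\<mu>)"

definition functional_equations ::
  "'x measure \<Rightarrow> 't measure \<Rightarrow> ('t \<Rightarrow> 'x \<Rightarrow> 't) \<Rightarrow> (nat \<Rightarrow> 't \<Rightarrow> 'x \<Rightarrow> real) \<Rightarrow>
   (nat \<Rightarrow> 't \<Rightarrow> real) \<Rightarrow> nat \<Rightarrow> (nat \<Rightarrow> 't \<Rightarrow> real) \<Rightarrow> bool" where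
  "functional_equations \<mu> St \<xi> pX_t g N \<rho> \<longleftrightarrow>
     (\<forall>n<N. \<forall>t\<in>space St. \<rho> n t = min (g n t) (continuation_cost \<mu> \<xi> pX_t \<rho> n t)) \<and>
     (\<forall>t\<in>space St. \<rho> N t = g N t)"

text \<open>Stop as soon as stopping is no more expensive than the optimal cost \<open>\<rho>\<^sub>n\<close>.\<close>
definition threshold_rule ::
  "'t \<Rightarrow> ('t \<Rightarrow> 'x \<Rightarrow> 't) \<Rightarrow> (nat \<Rightarrow> 't \<Rightarrow> real) \<Rightarrow> (nat \<Rightarrow> 't \<Rightarrow> real) \<Rightarrow>
   nat \<Rightarrow> (nat \<Rightarrow> 'x) \<Rightarrow> nat" where
  "threshold_rule t0 \<xi> g \<rho> n x =
     (if g n (stat t0 \<xi> n x) = \<rho> n (stat t0 \<xi> n x) then 1 else 0)"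

text \<open>
  At every time before the horizon that is reached, \<open>\<Psi>\<close> takes an action attaining the minimum in
  the functional equation; when stopping and continuing cost the same, either action is allowed.
\<close>
definition follows_equations ::
  "'w measure \<Rightarrow> 'x measure \<Rightarrow> (nat \<Rightarrow> 'w \<Rightarrow> 'x) \<Rightarrow> 't \<Rightarrow> ('t \<Rightarrow> 'x \<Rightarrow> 't) \<Rightarrow>
   (nat \<Rightarrow> 't \<Rightarrow> 'x \<Rightarrow> real) \<Rightarrow> (nat \<Rightarrow> 't \<Rightarrow> real) \<Rightarrow> nat \<Rightarrow> (nat \<Rightarrow> 't \<Rightarrow> real) \<Rightarrow>
   (nat \<Rightarrow> (nat \<Rightarrow> 'x) \<Rightarrow> nat) \<Rightarrow> bool" where
  "follows_equations M \<mu> X t0 \<xi> pX_t g N \<rho> \<Psi> \<longleftrightarrow>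
     (AE \<omega> in M. \<forall>n<N. (\<forall>i<n. \<Psi> i (obs X i \<omega>) = 0) \<longrightarrow>
        (let t = stat t0 \<xi> n (obs X n \<omega>) in
           (\<Psi> n (obs X n \<omega>) = 1 \<longrightarrow> \<rho> n t = g n t) \<and>
           (\<Psi> n (obs X n \<omega>) = 0 \<longrightarrow> \<rho> n t = continuation_cost \<mu> \<xi> pX_t \<rho> n t)))"

end

theory Submission
  imports Defs
begin

text \<open>
  Fix a solution \<open>\<rho>\<close> of the functional equations.  By sufficiency, the conditional law of \<open>X\<^sub>n\<^sub>+\<^sub>1\<close>
  given the whole history is \<open>p(x | t\<^sub>n) dx\<close>, so \<open>d\<^sub>n(t\<^sub>n)\<close> is one plus the conditional expectation
  of \<open>\<rho>\<^sub>n\<^sub>+\<^sub>1(t\<^sub>n\<^sub>+\<^sub>1)\<close>.  Telescoping \<open>E[1{\<tau> \<ge> n} (n + \<rho>\<^sub>n(t\<^sub>n))]\<close> over \<open>n\<close> then shows that the cost of any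
  rule exceeds \<open>\<rho>\<^sub>0(t\<^sub>0)\<close> by the sum over \<open>n < N\<close> of
  \<open>E[1{\<tau> = n} (g - \<rho>\<^sub>n)(t\<^sub>n) + 1{\<tau> > n} (d\<^sub>n - \<rho>\<^sub>n)(t\<^sub>n)]\<close>.  Every summand is nonnegative, and it vanishes
  exactly if the action taken at time \<open>n\<close> almost surely attains the minimum.
\<close>

text \<open>Otherwise \<open>{1..n}\<close> becomes \<open>{Suc 0..n}\<close>, and the measurability rules for histories no longer apply.\<close>

declare One_nat_def [simp del]

section \<open>Histories and the statistic\<close>

lemma stat_cong:
  assumes "\<And>k. 1 \<le> k \<Longrightarrow> k \<le> n \<Longrightarrow> x k = y k"
  shows "stat t0 \<xi> n x = stat t0 \<xi> n y"
  using assms by (induction n) auto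

lemma stat_fun_upd: "n < m \<Longrightarrow> stat t0 \<xi> n (x(m := y)) = stat t0 \<xi> n x"
  by (rule stat_cong) auto

lemma obs_Suc: "obs X (Suc n) \<omega> = (obs X n \<omega>)(Suc n := X (Suc n) \<omega>)"
  by (auto simp: obs_def fun_eq_iff)

lemma obs_restrict: "i \<le> n \<Longrightarrow> obs X i \<omega> = restrict (obs X n \<omega>) {1..i}"
  by (auto simp: obs_def fun_eq_iff)

section \<open>Integration against conditional densities\<close>

text \<open>The joint density is taken with respect to the law of \<open>Z\<close> times
  \<open>B\<close>, so Tonelli integrates over \<open>y\<close> first, and the outer integral is
  pulled back from the law of \<open>Z\<close> to \<open>M\<close>. All later conditioning goes
  through this formula.\<close>

lemma nn_integral_cond_density:
  assumes q: "cond_density M A Z B Y q" and B: "sigma_finite_measure B"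
    and [measurable]: "f \<in> borel_measurable (A \<Otimes>\<^sub>M B)"
  shows "(\<integral>\<^sup>+\<omega>. f (Z \<omega>, Y \<omega>) \<partial>M) = (\<integral>\<^sup>+\<omega>. \<integral>\<^sup>+y. ennreal (q (Z \<omega>) y) * f (Z \<omega>, y) \<partial>B \<partial>M)"
proof -
  interpret B: sigma_finite_measure B by fact
  have [measurable]: "Z \<in> measurable M A" "(\<lambda>(z, y). q z y) \<in> borel_measurable (A \<Otimes>\<^sub>M B)"
    and D: "distributed M (distr M A Z \<Otimes>\<^sub>M B) (\<lambda>\<omega>. (Z \<omega>, Y \<omega>)) (\<lambda>(z, y). ennreal (q z y))"
    using q by (auto simp: cond_density_def)
  have "(\<integral>\<^sup>+\<omega>. f (Z \<omega>, Y \<omega>) \<partial>M) =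
      (\<integral>\<^sup>+p. (\<lambda>(z, y). ennreal (q z y)) p * f p \<partial>(distr M A Z \<Otimes>\<^sub>M B))"
    by (subst distributed_nn_integral[OF D]) auto
  also have "\<dots> = (\<integral>\<^sup>+z. \<integral>\<^sup>+y. ennreal (q z y) * f (z, y) \<partial>B \<partial>distr M A Z)"
    by (subst B.nn_integral_fst[symmetric]) auto
  also have "\<dots> = (\<integral>\<^sup>+\<omega>. \<integral>\<^sup>+y. ennreal (q (Z \<omega>) y) * f (Z \<omega>, y) \<partial>B \<partial>M)"
    by (subst nn_integral_distr) auto
  finally show ?thesis .
qed

lemma cond_density_measurable:
  assumes "cond_density M A Z B Y q"
  shows "Z \<in> measurable M A" "(\<lambda>(z, y). q z y) \<in> borel_measurable (A \<Otimes>\<^sub>M B)"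
    "Y \<in> measurable M B"
proof -
  from assms have "(\<lambda>\<omega>. (Z \<omega>, Y \<omega>)) \<in> measurable M (distr M A Z \<Otimes>\<^sub>M B)"
    by (auto simp: cond_density_def dest: distributed_measurable)
  from measurable_snd'[OF this] show "Y \<in> measurable M B" by simp
qed (use assms in \<open>auto simp: cond_density_def\<close>)

text \<open>Testing the joint law on sets that constrain only \<open>Z\<close> shows that
  \<open>?q\<close> and the constant 1 are densities of the same measure with respect to the law of
  \<open>Z\<close>. Uniqueness of densities then gives equality almost everywhere.\<close>

lemma cond_density_normalized:
  assumes q: "cond_density M A Z B Y q" and M: "prob_space M" and B: "sigma_finite_measure B"
  shows "AE \<omega> in M. (\<integral>\<^sup>+y. ennreal (q (Z \<omega>) y) \<partial>B) = 1"
proof -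
  interpret prob_space M by fact
  interpret B: sigma_finite_measure B by fact
  note cond_density_measurable(1,2)[OF q, measurable]
  interpret D: prob_space "distr M A Z" by (rule prob_space_distr) simp
  let ?q = "\<lambda>z. \<integral>\<^sup>+y. ennreal (q z y) \<partial>B"
  have "density (distr M A Z) ?q = density (distr M A Z) (\<lambda>_. 1)"
  proof (rule measure_eqI)
    fix S assume "S \<in> sets (density (distr M A Z) ?q)"
    then have S [measurable]: "S \<in> sets A" by simp
    have "emeasure (density (distr M A Z) ?q) S = (\<integral>\<^sup>+\<omega>. ?q (Z \<omega>) * indicator S (Z \<omega>) \<partial>M)"
      by (simp add: emeasure_density nn_integral_distr)
    also have "\<dots> = (\<integral>\<^sup>+\<omega>. \<integral>\<^sup>+y. ennreal (q (Z \<omega>) y) * indicator S (Z \<omega>) \<partial>B \<partial>M)"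
      by (intro nn_integral_cong nn_integral_multc[symmetric]) measurable
    also have "\<dots> = (\<integral>\<^sup>+\<omega>. indicator S (Z \<omega>) \<partial>M)"
      using nn_integral_cond_density[OF q B, of "\<lambda>(z, y). indicator S z"] by simp
    also have "\<dots> = (\<integral>\<^sup>+z. indicator S z \<partial>distr M A Z)"
      by (rule nn_integral_distr[symmetric]) auto
    also have "\<dots> = emeasure (density (distr M A Z) (\<lambda>_. 1)) S"
      by (simp add: emeasure_density)
    finally show "emeasure (density (distr M A Z) ?q) S =
        emeasure (density (distr M A Z) (\<lambda>_. 1)) S" .
  qed simp
  then have "AE z in distr M A Z. ?q z = 1"
    by (intro D.density_unique) auto
  then show ?thesis by (intro AE_distrD[of Z M A]) auto
qed

section \<open>Variance of a density\<close>

lemma density_variance_nonneg: "(\<And>\<theta>. 0 \<le> q \<theta>) \<Longrightarrow> 0 \<le> density_variance q"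
  by (auto simp: density_variance_def intro!: Bochner_Integration.integral_nonneg)

text \<open>If the second moment is finite, then
  \<open>\<bar>\<theta>\<bar> \<le> \<theta>\<^sup>2 + 1\<close> makes the mean \<open>m\<close>
  finite, and the variance is the second moment minus \<open>m\<^sup>2\<close>. If it is infinite,
  the bound is trivial in \<open>ennreal\<close>.\<close>

lemma density_variance_le_second_moment:
  assumes [measurable]: "q \<in> borel_measurable lborel" and q0: "\<And>\<theta>. 0 \<le> q \<theta>"
    and q1: "(\<integral>\<^sup>+\<theta>. ennreal (q \<theta>) \<partial>lborel) = 1"
  shows "ennreal (density_variance q) \<le> (\<integral>\<^sup>+\<theta>. ennreal (q \<theta>) * ennreal (\<theta>\<^sup>2) \<partial>lborel)"
proof (cases "(\<integral>\<^sup>+\<theta>. ennreal (q \<theta>) * ennreal (\<theta>\<^sup>2) \<partial>lborel) = \<infinity>")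
  case False
  have i0: "integrable lborel q" and e0: "(\<integral>\<theta>. q \<theta> \<partial>lborel) = 1"
    using q0 q1 by (auto intro!: integrableI_nonneg simp: integral_eq_nn_integral)
  have i2: "integrable lborel (\<lambda>\<theta>. \<theta>\<^sup>2 * q \<theta>)"
    using False q0 by (intro integrableI_nonneg) (auto simp: ennreal_mult mult.commute less_top)
  have i1: "integrable lborel (\<lambda>\<theta>. \<theta> * q \<theta>)"
  proof (rule Bochner_Integration.integrable_bound)
    show "integrable lborel (\<lambda>\<theta>. \<theta>\<^sup>2 * q \<theta> + q \<theta>)" using i0 i2 by simp
    have "\<bar>\<theta>\<bar> * q \<theta> \<le> (\<theta>\<^sup>2 + 1) * q \<theta>" for \<theta>
    proof (rule mult_right_mono)
      have "0 \<le> (\<bar>\<theta>\<bar> - 1)\<^sup>2" by simp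
      also have "\<dots> = \<theta>\<^sup>2 + 1 - 2 * \<bar>\<theta>\<bar>" by (simp add: power2_diff)
      finally show "\<bar>\<theta>\<bar> \<le> \<theta>\<^sup>2 + 1" by simp
    qed (rule q0)
    then show "AE \<theta> in lborel. norm (\<theta> * q \<theta>) \<le> norm (\<theta>\<^sup>2 * q \<theta> + q \<theta>)"
      using q0 by (auto simp: abs_mult distrib_right)
  qed simp
  define m where "m = (\<integral>\<theta>. \<theta> * q \<theta> \<partial>lborel)"
  have "density_variance q = (\<integral>\<theta>. \<theta>\<^sup>2 * q \<theta> - 2 * m * (\<theta> * q \<theta>) + m\<^sup>2 * q \<theta> \<partial>lborel)"
    unfolding density_variance_def m_def[symmetric]
    by (intro Bochner_Integration.integral_cong) (auto simp: power2_eq_square algebra_simps)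
  also have "\<dots> = (\<integral>\<theta>. \<theta>\<^sup>2 * q \<theta> \<partial>lborel) - m\<^sup>2"
    using i0 i1 i2 by (simp add: e0 m_def[symmetric] power2_eq_square)
  finally have "density_variance q \<le> (\<integral>\<theta>. \<theta>\<^sup>2 * q \<theta> \<partial>lborel)" by simp
  then have "ennreal (density_variance q) \<le> ennreal (\<integral>\<theta>. \<theta>\<^sup>2 * q \<theta> \<partial>lborel)"
    by (rule ennreal_leI)
  also have "\<dots> = (\<integral>\<^sup>+\<theta>. ennreal (\<theta>\<^sup>2 * q \<theta>) \<partial>lborel)"
    using i2 q0 by (subst nn_integral_eq_integral) auto
  also have "\<dots> = (\<integral>\<^sup>+\<theta>. ennreal (q \<theta>) * ennreal (\<theta>\<^sup>2) \<partial>lborel)"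
    using q0 by (simp add: ennreal_mult mult.commute)
  finally show ?thesis .
qed simp

section \<open>Measurability in the model\<close>

context joint_detection_estimation
begin

abbreviation hist :: "nat \<Rightarrow> (nat \<Rightarrow> 'x) measure" where
  "hist n \<equiv> \<Pi>\<^sub>M k\<in>{1..n}. \<mu>"

abbreviation T :: "nat \<Rightarrow> 'w \<Rightarrow> 't" where
  "T n \<omega> \<equiv> stat t0 \<xi> n (obs X n \<omega>)"

lemma T_Suc: "T (Suc n) \<omega> = \<xi> (T n \<omega>) (X (Suc n) \<omega>)"
  by (simp add: obs_Suc stat_fun_upd)

lemma T_measurable [measurable]: "T n \<in> measurable M St"
  using cond_density_measurable(1)[OF pX_t] .

lemma X_measurable [measurable]: "X (Suc n) \<in> measurable M \<mu>"
  using cond_density_measurable(3)[OF pX_t] .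

lemma obs_measurable [measurable]: "obs X n \<in> measurable M (hist n)"
  using cond_density_measurable(1)[OF sufficient] .

lemma H_measurable [measurable]: "H \<in> measurable M (count_space {0, 1})"
  using cond_density_measurable(3)[OF pH_t] .

lemma \<Theta>_measurable [measurable]: "\<Theta> \<in> borel_measurable M"
  using cond_density_measurable(3)[OF p\<Theta>_t] by simp

declare pX_measurable [measurable] \<xi>_measurable [measurable]

lemma conditional_versions_measurable [measurable]:
  "(\<lambda>(t, x). pX_t n t x) \<in> borel_measurable (St \<Otimes>\<^sub>M \<mu>)"
  "(\<lambda>(t, i). pH_t n t i) \<in> borel_measurable (St \<Otimes>\<^sub>M count_space {0, 1})"
  "(\<lambda>(t, \<theta>). p\<Theta>_t n t \<theta>) \<in> borel_measurable (St \<Otimes>\<^sub>M lborel)"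
  "(\<lambda>(p, \<theta>). (\<lambda>(i, t). p\<Theta>_Ht n i t) p \<theta>) \<in> borel_measurable ((count_space {0, 1} \<Otimes>\<^sub>M St) \<Otimes>\<^sub>M lborel)"
  using cond_density_measurable(2)[OF pX_t] cond_density_measurable(2)[OF pH_t]
    cond_density_measurable(2)[OF p\<Theta>_t] cond_density_measurable(2)[OF p\<Theta>_Ht] by auto

text \<open>The length \<open>m\<close> of the history stays fixed, so that the whole induction on
  \<open>n\<close> takes place on one product space.\<close>

lemma stat_measurable [measurable]: "n \<le> m \<Longrightarrow> stat t0 \<xi> n \<in> measurable (hist m) St"
proof (induction n)
  case (Suc n)
  then have [measurable]: "stat t0 \<xi> n \<in> measurable (hist m) St" by simp
  have [measurable]: "(\<lambda>x. x (Suc n)) \<in> measurable (hist m) \<mu>"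
    using Suc.prems by (intro measurable_component_singleton) auto
  show ?case unfolding stat.simps by measurable
qed (simp add: t0_in stat.simps(1)[abs_def])

lemma sigma_finite_hist: "sigma_finite_measure (hist n)"
proof -
  interpret P: product_sigma_finite "\<lambda>_::nat. \<mu>" by standard
  show ?thesis by (rule P.sigma_finite) simp
qed

section \<open>The law of the next observation given the history\<close>

text \<open>Tonelli applied twice to the joint density. The history is innermost, so that its last
  coordinate can be split off for fixed \<open>i\<close> and \<open>\<theta>\<close>.\<close>

lemma nn_integral_model:
  assumes [measurable]:
    "F \<in> borel_measurable (count_space {0, 1} \<Otimes>\<^sub>M lborel \<Otimes>\<^sub>M hist n)"
  shows "(\<integral>\<^sup>+\<omega>. F (H \<omega>, \<Theta> \<omega>, obs X n \<omega>) \<partial>M) =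
    (\<integral>\<^sup>+i. \<integral>\<^sup>+\<theta>. \<integral>\<^sup>+x. ennreal ((\<Prod>k\<in>{1..n}. p\<^sub>X \<theta> (x k)) * p\<^sub>\<Theta> i \<theta> * p\<^sub>H i) *
      F (i, \<theta>, x) \<partial>hist n \<partial>lborel \<partial>count_space {0, 1})"
proof -
  let ?d = "\<lambda>(i, \<theta>, x). ennreal ((\<Prod>k\<in>{1..n}. p\<^sub>X \<theta> (x k)) * p\<^sub>\<Theta> i \<theta> * p\<^sub>H i)"
  let ?I = "count_space {0, 1::nat}"
  interpret P: sigma_finite_measure "hist n" by (rule sigma_finite_hist)
  interpret LP: sigma_finite_measure "lborel \<Otimes>\<^sub>M hist n"
    by (intro sigma_finite_pair_measure lborel.sigma_finite_measure_axioms P.sigma_finite_measure_axioms)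
  have [measurable]: "?d \<in> borel_measurable (?I \<Otimes>\<^sub>M lborel \<Otimes>\<^sub>M hist n)"
    using joint_density[of n] by (rule distributed_borel_measurable)
  have "(\<integral>\<^sup>+\<omega>. F (H \<omega>, \<Theta> \<omega>, obs X n \<omega>) \<partial>M) = (\<integral>\<^sup>+p. ?d p * F p \<partial>(?I \<Otimes>\<^sub>M lborel \<Otimes>\<^sub>M hist n))"
    by (subst distributed_nn_integral[OF joint_density]) auto
  also have "\<dots> = (\<integral>\<^sup>+i. \<integral>\<^sup>+q. ?d (i, q) * F (i, q) \<partial>(lborel \<Otimes>\<^sub>M hist n) \<partial>?I)"
    by (rule LP.nn_integral_fst[symmetric]) measurable
  also have "\<dots> = (\<integral>\<^sup>+i. \<integral>\<^sup>+\<theta>. \<integral>\<^sup>+x. ?d (i, \<theta>, x) * F (i, \<theta>, x) \<partial>hist n \<partial>lborel \<partial>?I)"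
    by (intro nn_integral_cong P.nn_integral_fst[symmetric]) measurable
  finally show ?thesis by simp
qed

text \<open>Given \<open>\<Theta>\<close>, the next observation is independent of the history: the
  joint density of \<open>Suc n\<close> observations is that of \<open>n\<close> observations times
  \<open>p\<^sub>X \<theta> y\<close>, and the product measure splits off the last coordinate
  accordingly.\<close>

lemma nn_integral_next_obs_given_parameter:
  assumes [measurable]: "F \<in> borel_measurable (hist n \<Otimes>\<^sub>M \<mu>)"
  shows "(\<integral>\<^sup>+\<omega>. F (obs X n \<omega>, X (Suc n) \<omega>) \<partial>M) =
    (\<integral>\<^sup>+\<omega>. \<integral>\<^sup>+y. ennreal (p\<^sub>X (\<Theta> \<omega>) y) * F (obs X n \<omega>, y) \<partial>\<mu> \<partial>M)"
proof -
  interpret P: product_sigma_finite "\<lambda>_::nat. \<mu>" by standard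
  let ?d = "\<lambda>n i \<theta> x. (\<Prod>k\<in>{1..n}. p\<^sub>X \<theta> (x k)) * p\<^sub>\<Theta> i \<theta> * p\<^sub>H i"
  have ins: "{1..Suc n} = insert (Suc n) {1..n}" by auto
  have [measurable]: "(\<lambda>x. x (Suc n)) \<in> measurable (hist (Suc n)) \<mu>"
    by (intro measurable_component_singleton) auto
  have [measurable]: "(\<lambda>x. restrict x {1..n}) \<in> measurable (hist (Suc n)) (hist n)"
    by (intro measurable_restrict_subset) auto
  have [measurable]: "k \<in> {1..n} \<Longrightarrow> (\<lambda>x. x k) \<in> measurable (hist n) \<mu>" for k
    by (intro measurable_component_singleton) auto
  have [measurable]: "p\<^sub>\<Theta> i \<in> borel_measurable lborel" if "i \<in> {0, 1}" for i
    using p\<Theta>_density[OF that] by simp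
  have m1: "(\<lambda>(i, \<theta>, x). F (restrict x {1..n}, x (Suc n)))
      \<in> borel_measurable (count_space {0, 1} \<Otimes>\<^sub>M lborel \<Otimes>\<^sub>M hist (Suc n))"
    by measurable
  \<comment> \<open>Both arguments of \<open>F\<close> are read off the longer history
    \<open>obs X (Suc n)\<close>, whose joint density with \<open>H\<close> and
    \<open>\<Theta>\<close> is known.\<close>
  have "(\<integral>\<^sup>+\<omega>. F (obs X n \<omega>, X (Suc n) \<omega>) \<partial>M) =
      (\<integral>\<^sup>+\<omega>. (\<lambda>(i, \<theta>, x). F (restrict x {1..n}, x (Suc n))) (H \<omega>, \<Theta> \<omega>, obs X (Suc n) \<omega>) \<partial>M)"
    by (simp add: obs_restrict[of n "Suc n"] obs_def)
  also have "\<dots> = (\<integral>\<^sup>+i. \<integral>\<^sup>+\<theta>. \<integral>\<^sup>+x. ennreal (?d (Suc n) i \<theta> x) *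
      F (restrict x {1..n}, x (Suc n)) \<partial>hist (Suc n) \<partial>lborel \<partial>count_space {0, 1})"
    by (subst nn_integral_model[OF m1]) simp
  also have "\<dots> = (\<integral>\<^sup>+i. \<integral>\<^sup>+\<theta>. \<integral>\<^sup>+x. ennreal (?d n i \<theta> x) *
      (\<integral>\<^sup>+y. ennreal (p\<^sub>X \<theta> y) * F (x, y) \<partial>\<mu>) \<partial>hist n \<partial>lborel \<partial>count_space {0, 1})"
  proof (intro nn_integral_cong)
    fix i \<theta> assume "i \<in> space (count_space {0, 1::nat})"
    then have i: "i \<in> {0, 1}" by simp
    have [measurable]: "p\<^sub>X \<theta> \<in> borel_measurable \<mu>" by measurable
    have m: "(\<lambda>x. ennreal (?d (Suc n) i \<theta> x) * F (restrict x {1..n}, x (Suc n)))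
        \<in> borel_measurable (hist (Suc n))"
    proof -
      have [measurable]: "k \<in> {1..Suc n} \<Longrightarrow> (\<lambda>x. x k) \<in> measurable (hist (Suc n)) \<mu>" for k
        by (intro measurable_component_singleton) auto
      show ?thesis by measurable
    qed
    have "(\<integral>\<^sup>+x. ennreal (?d (Suc n) i \<theta> x) * F (restrict x {1..n}, x (Suc n)) \<partial>hist (Suc n)) =
       (\<integral>\<^sup>+x. \<integral>\<^sup>+y. ennreal (?d (Suc n) i \<theta> (x(Suc n := y))) *
          F (restrict (x(Suc n := y)) {1..n}, y) \<partial>\<mu> \<partial>hist n)"
      using P.product_nn_integral_insert[of "{1..n}" "Suc n", OF _ _ m[unfolded ins]]
      unfolding ins by simp
    also have "\<dots> = (\<integral>\<^sup>+x. \<integral>\<^sup>+y. ennreal (?d n i \<theta> x) * (ennreal (p\<^sub>X \<theta> y) * F (x, y)) \<partial>\<mu> \<partial>hist n)"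
    proof (intro nn_integral_cong)
      fix x y assume x: "x \<in> space (hist n)" and y: "y \<in> space \<mu>"
      have r: "restrict (x(Suc n := y)) {1..n} = x"
        using x by (auto simp: space_PiM PiE_def extensional_def fun_eq_iff)
      have "(\<Prod>k\<in>{1..Suc n}. p\<^sub>X \<theta> ((x(Suc n := y)) k)) = p\<^sub>X \<theta> y * (\<Prod>k\<in>{1..n}. p\<^sub>X \<theta> (x k))"
        unfolding ins by (subst prod.insert) (auto intro!: prod.cong)
      then have "?d (Suc n) i \<theta> (x(Suc n := y)) = p\<^sub>X \<theta> y * ?d n i \<theta> x" by simp
      moreover have "0 \<le> p\<^sub>X \<theta> y" using pX_density y by auto
      moreover have "0 \<le> ?d n i \<theta> x"
        using pX_density p\<Theta>_density[OF i] prior i x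
        by (auto intro!: mult_nonneg_nonneg prod_nonneg simp: space_PiM PiE_def Pi_def)
      ultimately have "ennreal (?d (Suc n) i \<theta> (x(Suc n := y))) = ennreal (p\<^sub>X \<theta> y) * ennreal (?d n i \<theta> x)"
        by (simp only: ennreal_mult)
      then show "ennreal (?d (Suc n) i \<theta> (x(Suc n := y))) *
          F (restrict (x(Suc n := y)) {1..n}, y) =
          ennreal (?d n i \<theta> x) * (ennreal (p\<^sub>X \<theta> y) * F (x, y))"
        unfolding r by (simp only: mult_ac)
    qed
    also have "\<dots> = (\<integral>\<^sup>+x. ennreal (?d n i \<theta> x) * (\<integral>\<^sup>+y. ennreal (p\<^sub>X \<theta> y) * F (x, y) \<partial>\<mu>) \<partial>hist n)"
      by (intro nn_integral_cong nn_integral_cmult) measurable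
    finally show "(\<integral>\<^sup>+x. ennreal (?d (Suc n) i \<theta> x) *
        F (restrict x {1..n}, x (Suc n)) \<partial>hist (Suc n)) = \<dots>" .
  qed
  \<comment> \<open>The integral over \<open>y\<close> is now part of the integrand, a function of
    \<open>\<theta>\<close> and the shorter history, so the model integral for \<open>n\<close>
    observations can be folded back.\<close>
  also have "\<dots> = (\<integral>\<^sup>+\<omega>. (\<lambda>(i, \<theta>, x). \<integral>\<^sup>+y. ennreal (p\<^sub>X \<theta> y) * F (x, y) \<partial>\<mu>)
      (H \<omega>, \<Theta> \<omega>, obs X n \<omega>) \<partial>M)"
    by (subst nn_integral_model) auto
  finally show ?thesis by simp
qed

text \<open>Given the history, the density of \<open>\<Theta>\<close> depends on the statistic only, hence so does the predictive
  density \<open>r\<close> obtained by integrating out \<open>\<Theta>\<close>.  Testing with functions of the statistic identifies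
  \<open>r\<close> with \<open>pX_t n\<close> almost everywhere.\<close>

lemma next_obs_cond_density:
  assumes [measurable]: "F \<in> borel_measurable (hist n \<Otimes>\<^sub>M \<mu>)"
  shows "(\<integral>\<^sup>+\<omega>. F (obs X n \<omega>, X (Suc n) \<omega>) \<partial>M) =
    (\<integral>\<^sup>+\<omega>. \<integral>\<^sup>+y. ennreal (pX_t n (T n \<omega>) y) * F (obs X n \<omega>, y) \<partial>\<mu> \<partial>M)"
proof -
  interpret \<mu>L: pair_sigma_finite \<mu> "lborel :: real measure" by standard
  define r where "r t y = (\<integral>\<^sup>+\<theta>. ennreal (p\<Theta>_t n t \<theta>) * ennreal (p\<^sub>X \<theta> y) \<partial>lborel)" for t y
  have r_measurable [measurable]: "(\<lambda>p. r (fst p) (snd p)) \<in> borel_measurable (St \<Otimes>\<^sub>M \<mu>)"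
    unfolding r_def by measurable
  \<comment> \<open>Stated for every \<open>F\<close>, since it is needed twice: for indicators of
    events in the statistic and the next observation, which identify \<open>r\<close>, and at the
    end for the given \<open>F\<close>.\<close>
  have *: "(\<integral>\<^sup>+\<omega>. F (obs X n \<omega>, X (Suc n) \<omega>) \<partial>M) =
      (\<integral>\<^sup>+\<omega>. \<integral>\<^sup>+y. r (T n \<omega>) y * F (obs X n \<omega>, y) \<partial>\<mu> \<partial>M)"
    if [measurable]: "F \<in> borel_measurable (hist n \<Otimes>\<^sub>M \<mu>)" for F
  proof -
    have "(\<integral>\<^sup>+\<omega>. F (obs X n \<omega>, X (Suc n) \<omega>) \<partial>M) =
        (\<integral>\<^sup>+\<omega>. (\<lambda>(x, \<theta>). \<integral>\<^sup>+y. ennreal (p\<^sub>X \<theta> y) * F (x, y) \<partial>\<mu>) (obs X n \<omega>, \<Theta> \<omega>) \<partial>M)"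
      using nn_integral_next_obs_given_parameter[of F n] by simp
    \<comment> \<open>Sufficiency enters here: the density of \<open>\<Theta>\<close> given the
      whole history is evaluated at the statistic.\<close>
    also have "\<dots> = (\<integral>\<^sup>+\<omega>. \<integral>\<^sup>+\<theta>. ennreal (p\<Theta>_t n (T n \<omega>) \<theta>) *
        (\<integral>\<^sup>+y. ennreal (p\<^sub>X \<theta> y) * F (obs X n \<omega>, y) \<partial>\<mu>) \<partial>lborel \<partial>M)"
      by (subst nn_integral_cond_density[OF sufficient lborel.sigma_finite_measure_axioms]) auto
    also have "\<dots> = (\<integral>\<^sup>+\<omega>. \<integral>\<^sup>+y. r (T n \<omega>) y * F (obs X n \<omega>, y) \<partial>\<mu> \<partial>M)"
    proof (intro nn_integral_cong)
      fix \<omega> assume \<omega>: "\<omega> \<in> space M"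
      have [measurable]: "T n \<omega> \<in> space St" "obs X n \<omega> \<in> space (hist n)"
        using measurable_space[OF T_measurable \<omega>] measurable_space[OF obs_measurable \<omega>] by auto
      let ?q = "p\<Theta>_t n (T n \<omega>)" and ?G = "\<lambda>y. F (obs X n \<omega>, y)"
      have [measurable]: "?q \<in> borel_measurable lborel" "?G \<in> borel_measurable \<mu>" by measurable
      have "(\<integral>\<^sup>+\<theta>. ennreal (?q \<theta>) * (\<integral>\<^sup>+y. ennreal (p\<^sub>X \<theta> y) * ?G y \<partial>\<mu>) \<partial>lborel) =
          (\<integral>\<^sup>+\<theta>. \<integral>\<^sup>+y. ennreal (?q \<theta>) * (ennreal (p\<^sub>X \<theta> y) * ?G y) \<partial>\<mu> \<partial>lborel)"
        by (intro nn_integral_cong nn_integral_cmult[symmetric]) measurable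
      also have "\<dots> = (\<integral>\<^sup>+y. \<integral>\<^sup>+\<theta>. ennreal (?q \<theta>) * ennreal (p\<^sub>X \<theta> y) * ?G y \<partial>lborel \<partial>\<mu>)"
        by (subst \<mu>L.Fubini') (auto simp: mult.assoc)
      also have "\<dots> = (\<integral>\<^sup>+y. r (T n \<omega>) y * ?G y \<partial>\<mu>)"
        unfolding r_def by (intro nn_integral_cong nn_integral_multc) measurable
      finally show "(\<integral>\<^sup>+\<theta>. ennreal (?q \<theta>) * (\<integral>\<^sup>+y. ennreal (p\<^sub>X \<theta> y) * ?G y \<partial>\<mu>) \<partial>lborel) = \<dots>" .
    qed
    finally show ?thesis .
  qed
  let ?D = "distr M St (T n)"
  interpret D: prob_space ?D by (rule prob_space_distr) simp
  interpret D\<mu>: pair_sigma_finite ?D \<mu> by standard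
  have "density (?D \<Otimes>\<^sub>M \<mu>) (\<lambda>p. r (fst p) (snd p)) =
      density (?D \<Otimes>\<^sub>M \<mu>) (\<lambda>p. ennreal (pX_t n (fst p) (snd p)))"
  proof (rule measure_eqI)
    fix A assume "A \<in> sets (density (?D \<Otimes>\<^sub>M \<mu>) (\<lambda>p. r (fst p) (snd p)))"
    then have A[measurable]: "A \<in> sets (St \<Otimes>\<^sub>M \<mu>)" by (simp cong: sets_pair_measure_cong)
    have A'[measurable]: "A \<in> sets (?D \<Otimes>\<^sub>M \<mu>)" using A by (simp cong: sets_pair_measure_cong)
    have e: "emeasure (density (?D \<Otimes>\<^sub>M \<mu>) f) A = (\<integral>\<^sup>+\<omega>. \<integral>\<^sup>+y. f (T n \<omega>, y) * indicator A (T n \<omega>, y) \<partial>\<mu> \<partial>M)"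
      if [measurable]: "f \<in> borel_measurable (St \<Otimes>\<^sub>M \<mu>)" for f
    proof -
      have "emeasure (density (?D \<Otimes>\<^sub>M \<mu>) f) A = (\<integral>\<^sup>+p. f p * indicator A p \<partial>(?D \<Otimes>\<^sub>M \<mu>))"
        by (rule emeasure_density) auto
      also have "\<dots> = (\<integral>\<^sup>+t. \<integral>\<^sup>+y. f (t, y) * indicator A (t, y) \<partial>\<mu> \<partial>?D)"
        by (rule \<mu>.nn_integral_fst[symmetric]) measurable
      finally show ?thesis by (subst (asm) nn_integral_distr) auto
    qed
    have [measurable]: "stat t0 \<xi> n \<in> measurable (hist n) St" by simp
    have i: "(\<lambda>(x, y). indicator A (stat t0 \<xi> n x, y) :: ennreal) \<in> borel_measurable (hist n \<Otimes>\<^sub>M \<mu>)"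
      by measurable
    have "(\<integral>\<^sup>+\<omega>. \<integral>\<^sup>+y. r (T n \<omega>) y * indicator A (T n \<omega>, y) \<partial>\<mu> \<partial>M) =
        (\<integral>\<^sup>+\<omega>. indicator A (T n \<omega>, X (Suc n) \<omega>) \<partial>M)"
      using *[OF i] by simp
    also have "\<dots> = (\<integral>\<^sup>+\<omega>. \<integral>\<^sup>+y. ennreal (pX_t n (T n \<omega>) y) * indicator A (T n \<omega>, y) \<partial>\<mu> \<partial>M)"
      by (rule nn_integral_cond_density[OF pX_t]) (auto intro: \<mu>.sigma_finite_measure_axioms)
    finally show "emeasure (density (?D \<Otimes>\<^sub>M \<mu>) (\<lambda>p. r (fst p) (snd p))) A =
        emeasure (density (?D \<Otimes>\<^sub>M \<mu>) (\<lambda>p. ennreal (pX_t n (fst p) (snd p)))) A"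
      by (simp add: e)
  qed simp
  then have "AE p in ?D \<Otimes>\<^sub>M \<mu>. r (fst p) (snd p) = ennreal (pX_t n (fst p) (snd p))"
    by (intro D\<mu>.density_unique) auto
  \<comment> \<open>Splitting the exceptional null set of the product into sections allows
    \<open>r\<close> to be replaced inside the integral over \<open>y\<close>.\<close>
  then have "AE t in ?D. AE y in \<mu>. r t y = ennreal (pX_t n t y)"
    by (drule_tac D\<mu>.AE_pair) simp
  then have "AE \<omega> in M. AE y in \<mu>. r (T n \<omega>) y = ennreal (pX_t n (T n \<omega>) y)"
    by (intro AE_distrD[of "T n" M St]) auto
  then have "(\<integral>\<^sup>+\<omega>. \<integral>\<^sup>+y. r (T n \<omega>) y * F (obs X n \<omega>, y) \<partial>\<mu> \<partial>M) =
      (\<integral>\<^sup>+\<omega>. \<integral>\<^sup>+y. ennreal (pX_t n (T n \<omega>) y) * F (obs X n \<omega>, y) \<partial>\<mu> \<partial>M)"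
    by (intro nn_integral_cong_AE) (elim eventually_mono, intro nn_integral_cong_AE, auto)
  with *[of F] show ?thesis by simp
qed

section \<open>Integrability of the stopping cost\<close>

lemma pH_t_nonneg: "t \<in> space St \<Longrightarrow> i \<in> {0, 1} \<Longrightarrow> 0 \<le> pH_t n t i"
  using pH_t[of n] by (auto simp: cond_density_def)

lemma p\<Theta>_Ht_nonneg: "t \<in> space St \<Longrightarrow> i \<in> {0, 1} \<Longrightarrow> 0 \<le> p\<Theta>_Ht n i t \<theta>"
  using p\<Theta>_Ht[of n] by (force simp: cond_density_def space_pair_measure)

lemma pX_t_nonneg: "t \<in> space St \<Longrightarrow> x \<in> space \<mu> \<Longrightarrow> 0 \<le> pX_t n t x"
  using pX_t[of n] by (auto simp: cond_density_def)

lemma T_space: "\<omega> \<in> space M \<Longrightarrow> T n \<omega> \<in> space St"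
  using measurable_space[OF T_measurable] .

lemma \<xi>_space: "t \<in> space St \<Longrightarrow> x \<in> space \<mu> \<Longrightarrow> \<xi> t x \<in> space St"
  using measurable_space[OF \<xi>_measurable, of "(t, x)"] by (auto simp: space_pair_measure)

lemma posterior_variance_measurable [measurable]:
  "(\<lambda>p. density_variance (p\<Theta>_Ht n (fst p) (snd p))) \<in> borel_measurable (count_space {0, 1} \<Otimes>\<^sub>M St)"
proof -
  have [measurable]: "(\<lambda>(p, \<theta>). p\<Theta>_Ht n (fst p) (snd p) \<theta>)
      \<in> borel_measurable ((count_space {0, 1} \<Otimes>\<^sub>M St) \<Otimes>\<^sub>M lborel)"
    using conditional_versions_measurable(4)[of n] by (simp add: split_beta')
  show ?thesis unfolding density_variance_def by measurable
qed

lemma pH_t_measurable [measurable]: "i \<in> {0, 1} \<Longrightarrow> (\<lambda>t. pH_t n t i) \<in> borel_measurable St"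
  using measurable_compose[OF measurable_Pair[OF measurable_ident measurable_const] conditional_versions_measurable(2)]
  by simp

lemma posterior_variance_measurable' [measurable]:
  assumes "i \<in> {0, 1}"
  shows "(\<lambda>t. density_variance (p\<Theta>_Ht n i t)) \<in> borel_measurable St"
proof -
  have "(\<lambda>t. (i, t)) \<in> measurable St (count_space {0, 1} \<Otimes>\<^sub>M St)" using assms by simp
  from measurable_compose[OF this posterior_variance_measurable] show ?thesis by simp
qed

text \<open>As \<open>{0, 1}\<close> is countable, measurability of each section of \<open>f\<close>
  yields joint measurability, and the integral over the conditional law of \<open>H\<close> is a sum
  of two terms.\<close>

lemma nn_integral_pH_t:
  assumes f: "\<And>i. i \<in> {0, 1} \<Longrightarrow> f i \<in> borel_measurable St"
  shows "(\<integral>\<^sup>+\<omega>. f (H \<omega>) (T n \<omega>) \<partial>M) =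
    (\<integral>\<^sup>+\<omega>. ennreal (pH_t n (T n \<omega>) 0) * f 0 (T n \<omega>) + ennreal (pH_t n (T n \<omega>) 1) * f 1 (T n \<omega>) \<partial>M)"
proof -
  have m: "(\<lambda>p. f (snd p) (fst p)) \<in> borel_measurable (St \<Otimes>\<^sub>M count_space {0, 1})"
    by (subst measurable_pair_swap_iff, rule measurable_pair_measure_countable1) (use f in auto)
  have "(\<integral>\<^sup>+\<omega>. f (H \<omega>) (T n \<omega>) \<partial>M) =
      (\<integral>\<^sup>+\<omega>. \<integral>\<^sup>+i. ennreal (pH_t n (T n \<omega>) i) * f i (T n \<omega>) \<partial>count_space {0, 1} \<partial>M)"
    using nn_integral_cond_density[OF pH_t sigma_finite_measure_count_space_finite m] by simp
  then show ?thesis by (simp add: nn_integral_count_space_finite)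
qed

text \<open>Both posterior probabilities are nonnegative, and \<open>nn_integral_pH_t\<close> with
  the constant function 1 shows that their means add up to 1.\<close>

lemma posterior_probability_integrable:
  assumes "i \<in> {0, 1}"
  shows "integrable M (\<lambda>\<omega>. pH_t n (T n \<omega>) i)"
proof (rule integrableI_nonneg)
  have "(\<integral>\<^sup>+\<omega>. ennreal (pH_t n (T n \<omega>) i) \<partial>M) \<le>
      (\<integral>\<^sup>+\<omega>. ennreal (pH_t n (T n \<omega>) 0) * 1 + ennreal (pH_t n (T n \<omega>) 1) * 1 \<partial>M)"
    using assms by (intro nn_integral_mono) auto
  also have "\<dots> = 1"
    by (subst nn_integral_pH_t[of "\<lambda>_ _. 1", symmetric]) (auto simp: emeasure_space_1)
  also have "\<dots> < \<infinity>" by simp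
  finally show "(\<integral>\<^sup>+\<omega>. ennreal (pH_t n (T n \<omega>) i) \<partial>M) < \<infinity>" .
qed (use assms T_space pH_t_nonneg in auto)

text \<open>Summed over \<open>i\<close>, the terms have mean \<open>E[V(H, T n)]\<close>, where
  \<open>V\<close> is the posterior variance; this is at most the mean of the conditional second
  moment, which is \<open>E[\<Theta>\<^sup>2]\<close>. The variance bound is applied only at the
  actual pair of \<open>H\<close> and \<open>T n\<close>, because that is where
  \<open>p\<Theta>_Ht\<close> integrates to 1 almost surely.\<close>

lemma posterior_variance_integrable:
  assumes i: "i \<in> {0, 1}"
  shows "integrable M (\<lambda>\<omega>. pH_t n (T n \<omega>) i * density_variance (p\<Theta>_Ht n i (T n \<omega>)))"
proof (rule integrableI_nonneg)
  let ?V = "\<lambda>i t. density_variance (p\<Theta>_Ht n i t)"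
  have V0: "0 \<le> ?V i t" if "t \<in> space St" "i \<in> {0, 1}" for i t
    using p\<Theta>_Ht_nonneg[OF that] by (rule density_variance_nonneg)
  show "AE \<omega> in M. 0 \<le> pH_t n (T n \<omega>) i * ?V i (T n \<omega>)"
    using i T_space pH_t_nonneg V0 by auto
  have "(\<integral>\<^sup>+\<omega>. ennreal (pH_t n (T n \<omega>) i * ?V i (T n \<omega>)) \<partial>M) \<le>
      (\<integral>\<^sup>+\<omega>. ennreal (pH_t n (T n \<omega>) 0) * ennreal (?V 0 (T n \<omega>)) +
        ennreal (pH_t n (T n \<omega>) 1) * ennreal (?V 1 (T n \<omega>)) \<partial>M)"
    using i by (intro nn_integral_mono) (auto simp: ennreal_mult pH_t_nonneg V0 T_space)
  also have "\<dots> = (\<integral>\<^sup>+\<omega>. ennreal (?V (H \<omega>) (T n \<omega>)) \<partial>M)"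
    by (rule nn_integral_pH_t[of "\<lambda>i t. ennreal (?V i t)", symmetric]) measurable
  also have "\<dots> \<le> (\<integral>\<^sup>+\<omega>. \<integral>\<^sup>+\<theta>. ennreal (p\<Theta>_Ht n (H \<omega>) (T n \<omega>) \<theta>) * ennreal (\<theta>\<^sup>2) \<partial>lborel \<partial>M)"
  proof (rule nn_integral_mono_AE)
    have "AE \<omega> in M. (\<integral>\<^sup>+\<theta>. ennreal (p\<Theta>_Ht n (H \<omega>) (T n \<omega>) \<theta>) \<partial>lborel) = 1"
      using cond_density_normalized[OF p\<Theta>_Ht prob_space_axioms lborel.sigma_finite_measure_axioms]
      by simp
    then show "AE \<omega> in M. ennreal (?V (H \<omega>) (T n \<omega>)) \<le>
        (\<integral>\<^sup>+\<theta>. ennreal (p\<Theta>_Ht n (H \<omega>) (T n \<omega>) \<theta>) * ennreal (\<theta>\<^sup>2) \<partial>lborel)"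
      using AE_space
    proof eventually_elim
      case (elim \<omega>)
      have h: "H \<omega> \<in> {0, 1}" using measurable_space[OF H_measurable elim(2)] by simp
      have "(H \<omega>, T n \<omega>) \<in> space (count_space {0, 1} \<Otimes>\<^sub>M St)"
        using h T_space[OF elim(2)] by (simp add: space_pair_measure)
      from measurable_compose[OF measurable_Pair1'[OF this] conditional_versions_measurable(4)[of n]]
      have "p\<Theta>_Ht n (H \<omega>) (T n \<omega>) \<in> borel_measurable lborel" by simp
      then show ?case
        using elim(1) p\<Theta>_Ht_nonneg[OF T_space[OF elim(2)] h]
        by (intro density_variance_le_second_moment) auto
    qed
  qed
  also have "\<dots> = (\<integral>\<^sup>+\<omega>. ennreal ((\<Theta> \<omega>)\<^sup>2) \<partial>M)"
    using nn_integral_cond_density[OF p\<Theta>_Ht lborel.sigma_finite_measure_axioms,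
        of "\<lambda>(p, \<theta>). ennreal (\<theta>\<^sup>2)"] by simp
  also have "\<dots> < \<infinity>"
    using second_moment by (simp add: real_integrable_def less_top)
  finally show "(\<integral>\<^sup>+\<omega>. ennreal (pH_t n (T n \<omega>) i * ?V i (T n \<omega>)) \<partial>M) < \<infinity>" .
qed (use i in measurable)

lemma Dstar_properties:
  assumes C: "\<forall>i\<le>3. 0 \<le> C i" and i: "i \<in> {0, 1}"
  shows "Dstar C pH_t p\<Theta>_Ht i n \<in> borel_measurable St"
    and "t \<in> space St \<Longrightarrow> 0 \<le> Dstar C pH_t p\<Theta>_Ht i n t"
    and "integrable M (\<lambda>\<omega>. Dstar C pH_t p\<Theta>_Ht i n (T n \<omega>))"
proof -
  \<comment> \<open>Subtraction of naturals is truncated, so this holds for every \<open>i\<close>;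
    on \<open>{0, 1}\<close> the map exchanges the two hypotheses.\<close>
  have i': "1 - i \<in> {0, 1}" by auto
  have "0 \<le> C (1 - i)" "0 \<le> C (2 + i)" using C i by auto
  then show "t \<in> space St \<Longrightarrow> 0 \<le> Dstar C pH_t p\<Theta>_Ht i n t"
    using i i' by (auto simp: Dstar_def pH_t_nonneg p\<Theta>_Ht_nonneg
        intro!: add_nonneg_nonneg mult_nonneg_nonneg density_variance_nonneg)
  show "Dstar C pH_t p\<Theta>_Ht i n \<in> borel_measurable St"
    unfolding Dstar_def[abs_def] using i i' by measurable
  show "integrable M (\<lambda>\<omega>. Dstar C pH_t p\<Theta>_Ht i n (T n \<omega>))"
    unfolding Dstar_def mult.assoc
    using posterior_probability_integrable[OF i'] posterior_variance_integrable[OF i]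
    by (intro Bochner_Integration.integrable_add integrable_mult_right) auto
qed

text \<open>These are the properties of the cost that the dynamic programming argument below assumes
  of \<open>g\<close>.\<close>

lemma stop_cost_properties:
  assumes C: "\<forall>i\<le>3. 0 \<le> C i"
  shows "stop_cost C pH_t p\<Theta>_Ht n \<in> borel_measurable St"
    and "t \<in> space St \<Longrightarrow> 0 \<le> stop_cost C pH_t p\<Theta>_Ht n t"
    and "integrable M (\<lambda>\<omega>. stop_cost C pH_t p\<Theta>_Ht n (T n \<omega>))"
  using Dstar_properties[OF C, where i = 0 and n = n] Dstar_properties[OF C, where i = 1 and n = n]
  by (auto simp: stop_cost_def[abs_def])

section \<open>Stopping rules and the event of not having stopped\<close>

text \<open>For a stopping rule this is the indicator of \<open>\<tau> \<ge> n\<close>, as only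
  times before \<open>n\<close> enter. Going on after time \<open>n\<close> is therefore
  \<open>surviving \<Psi> (Suc n)\<close>.\<close>

abbreviation surviving :: "(nat \<Rightarrow> (nat \<Rightarrow> 'x) \<Rightarrow> nat) \<Rightarrow> nat \<Rightarrow> 'w \<Rightarrow> real" where
  "surviving \<Psi> n \<omega> \<equiv> (\<Prod>i<n. 1 - real (\<Psi> i (obs X i \<omega>)))"

lemma rule_cases:
  assumes "stopping_rule \<mu> N \<Psi>" "n \<le> N" "x \<in> space (hist n)"
  obtains "\<Psi> n x = 0" | "\<Psi> n x = 1"
  using measurable_space[of "\<Psi> n" "hist n" "count_space {0, 1}" x] assms
  by (auto simp: stopping_rule_def)

lemma obs_space: "\<omega> \<in> space M \<Longrightarrow> obs X n \<omega> \<in> space (hist n)"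
  using measurable_space[OF obs_measurable] .

text \<open>Every factor is 0 or 1. The bound is \<open>Suc N\<close> because the product up to
  \<open>n\<close> consults the rule only at times below \<open>n\<close>.\<close>

lemma surviving_eq:
  assumes \<Psi>: "stopping_rule \<mu> N \<Psi>" and "n \<le> Suc N" and \<omega>: "\<omega> \<in> space M"
  shows "surviving \<Psi> n \<omega> = (if \<forall>i<n. \<Psi> i (obs X i \<omega>) = 0 then 1 else 0)"
  using assms(2)
proof (induction n)
  case (Suc n)
  then have IH: "surviving \<Psi> n \<omega> = (if \<forall>i<n. \<Psi> i (obs X i \<omega>) = 0 then 1 else 0)" and "n \<le> N"
    by simp_all
  from rule_cases[OF \<Psi> this(2) obs_space[OF \<omega>]] show ?case
    by cases (simp_all only: prod.lessThan_Suc IH All_less_Suc, simp_all)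
qed simp

lemma rule_measurable:
  assumes "stopping_rule \<mu> N \<Psi>" "n \<le> N"
  shows "(\<lambda>x. real (\<Psi> n x)) \<in> borel_measurable (hist n)"
  using assms by (auto simp: stopping_rule_def intro: measurable_compose[of _ _ "count_space {0, 1}"])

lemma surviving_measurable:
  assumes \<Psi>: "stopping_rule \<mu> N \<Psi>" and n: "n \<le> Suc N"
  shows "surviving \<Psi> n \<in> borel_measurable M"
proof (rule borel_measurable_prod)
  fix i assume "i \<in> {..<n}"
  then have "i \<le> N" using n by auto
  from measurable_compose[OF obs_measurable rule_measurable[OF \<Psi> this]]
  show "(\<lambda>\<omega>. 1 - real (\<Psi> i (obs X i \<omega>))) \<in> borel_measurable M" by simp
qed

lemma stop_at_measurable:
  assumes "stopping_rule \<mu> N \<Psi>" "n \<le> N"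
  shows "stop_at X \<Psi> n \<in> borel_measurable M"
  unfolding stop_at_def[abs_def]
  using measurable_compose[OF obs_measurable rule_measurable[OF assms]]
    surviving_measurable[OF assms(1), of n] assms(2) by simp

text \<open>The identity behind the telescoping: \<open>\<tau> = n\<close> means
  \<open>\<tau> \<ge> n\<close> but not \<open>\<tau> > n\<close>.\<close>

lemma stop_at_surviving: "stop_at X \<Psi> n \<omega> = surviving \<Psi> n \<omega> - surviving \<Psi> (Suc n) \<omega>"
  by (simp add: stop_at_def algebra_simps)

lemma stop_at_eq:
  assumes "stopping_rule \<mu> N \<Psi>" "n \<le> N" "\<omega> \<in> space M"
  shows "stop_at X \<Psi> n \<omega> =
    (if (\<forall>i<n. \<Psi> i (obs X i \<omega>) = 0) \<and> \<Psi> n (obs X n \<omega>) = 1 then 1 else 0)"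
proof -
  have s: "surviving \<Psi> n \<omega> = (if \<forall>i<n. \<Psi> i (obs X i \<omega>) = 0 then 1 else 0)"
    using assms by (intro surviving_eq) auto
  from rule_cases[OF assms(1,2) obs_space[OF assms(3)]] show ?thesis
    by cases (simp_all only: stop_at_def s, simp_all)
qed

lemma integrable_mult_unit_interval:
  fixes f h :: "'w \<Rightarrow> real"
  assumes "integrable M h" "f \<in> borel_measurable M" "\<And>\<omega>. \<omega> \<in> space M \<Longrightarrow> 0 \<le> f \<omega> \<and> f \<omega> \<le> 1"
  shows "integrable M (\<lambda>\<omega>. f \<omega> * h \<omega>)"
proof (rule Bochner_Integration.integrable_bound[OF assms(1)])
  show "AE \<omega> in M. norm (f \<omega> * h \<omega>) \<le> norm (h \<omega>)"
    using assms(3) by (intro AE_I2) (auto simp: abs_mult intro!: mult_left_le_one_le)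
qed (use assms in auto)

section \<open>Dynamic programming for a fixed solution of the functional equations\<close>

context
  fixes N :: nat and g \<rho> :: "nat \<Rightarrow> 't \<Rightarrow> real"
  assumes g_measurable [measurable]: "\<And>n. g n \<in> borel_measurable St"
    and g_nonneg: "\<And>n t. t \<in> space St \<Longrightarrow> 0 \<le> g n t"
    and g_integrable: "\<And>n. integrable M (\<lambda>\<omega>. g n (T n \<omega>))"
    and equations: "functional_equations \<mu> St \<xi> pX_t g N \<rho>"
begin

abbreviation d :: "nat \<Rightarrow> 't \<Rightarrow> real" where
  "d \<equiv> continuation_cost \<mu> \<xi> pX_t \<rho>"

lemma value_eq: "n < N \<Longrightarrow> t \<in> space St \<Longrightarrow> \<rho> n t = min (g n t) (d n t)"
  and value_horizon: "t \<in> space St \<Longrightarrow> \<rho> N t = g N t"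
  using equations by (auto simp: functional_equations_def)

text \<open>Backward induction from the horizon, where \<open>\<rho>\<close> is the stopping cost.
  The equations determine \<open>\<rho> n\<close> on \<open>space St\<close>, which suffices for
  measurability by congruence.\<close>

lemma value_properties:
  "n \<le> N \<Longrightarrow> \<rho> n \<in> borel_measurable St \<and> (\<forall>t\<in>space St. 0 \<le> \<rho> n t)"
proof (induction rule: inc_induct)
  case base
  then show ?case
    using value_horizon g_nonneg g_measurable[of N] by (simp cong: measurable_cong)
next
  case (step n)
  then have [measurable]: "\<rho> (Suc n) \<in> borel_measurable St" by simp
  have "(\<lambda>t. min (g n t) (d n t)) \<in> borel_measurable St"
    unfolding continuation_cost_def by measurable
  \<comment> \<open>This covers an integrand that is not integrable: the Bochner integral is then 0
    by default.\<close>
  moreover have "0 \<le> d n t" if "t \<in> space St" for t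
    unfolding continuation_cost_def using step that \<xi>_space pX_t_nonneg
    by (intro add_nonneg_nonneg Bochner_Integration.integral_nonneg) auto
  ultimately show ?case
    using step.hyps value_eq g_nonneg by (simp cong: measurable_cong)
qed

lemma value_measurable: "n \<le> N \<Longrightarrow> \<rho> n \<in> borel_measurable St"
  and value_nonneg: "n \<le> N \<Longrightarrow> t \<in> space St \<Longrightarrow> 0 \<le> \<rho> n t"
  using value_properties by auto

lemma value_le_stop: "n \<le> N \<Longrightarrow> t \<in> space St \<Longrightarrow> \<rho> n t \<le> g n t"
  using value_eq value_horizon by (cases "n < N") (auto simp: not_less)

text \<open>Domination: \<open>0 \<le> \<rho> n \<le> g n\<close> on the state space, and
  \<open>g n\<close> is integrable along the statistic.\<close>

lemma value_integrable: "n \<le> N \<Longrightarrow> integrable M (\<lambda>\<omega>. \<rho> n (T n \<omega>))"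
  using value_measurable value_nonneg value_le_stop T_space
  by (intro Bochner_Integration.integrable_bound[OF g_integrable[of n]] AE_I2)
    (auto intro: measurable_compose[OF T_measurable] order_trans[OF _ abs_ge_self])

text \<open>With the weight \<open>a\<close> ranging over functions of the history, this says that
  \<open>d n (T n \<omega>) - 1\<close> is the conditional expectation of the next value given the
  whole history, not just given the statistic. Rules may depend on the whole history, so this
  stronger form is the one required.\<close>

lemma continuation_step:
  assumes n: "n < N" and a [measurable]: "a \<in> borel_measurable (hist n)"
    and a01: "\<And>x. x \<in> space (hist n) \<Longrightarrow> 0 \<le> a x \<and> a x \<le> 1"
  shows "has_bochner_integral M (\<lambda>\<omega>. a (obs X n \<omega>) * (d n (T n \<omega>) - 1))
    (\<integral>\<omega>. a (obs X n \<omega>) * \<rho> (Suc n) (T (Suc n) \<omega>) \<partial>M)"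
proof -
  have [measurable]: "\<rho> (Suc n) \<in> borel_measurable St" using n value_measurable by simp
  have r0: "0 \<le> \<rho> (Suc n) t" if "t \<in> space St" for t using n that value_nonneg by simp
  have [measurable]: "stat t0 \<xi> n \<in> measurable (hist n) St" by simp
  \<comment> \<open>The \<open>ennreal\<close> counterpart of \<open>d n t - 1\<close>. The two
    differ where \<open>K\<close> is infinite, since the Bochner integral is 0 there; the remaining
    work is to show that this happens with probability 0.\<close>
  define K where "K t = (\<integral>\<^sup>+y. ennreal (pX_t n t y) * ennreal (\<rho> (Suc n) (\<xi> t y)) \<partial>\<mu>)" for t
  have [measurable]: "K \<in> borel_measurable St" unfolding K_def by measurable
  have step: "(\<integral>\<^sup>+\<omega>. ennreal (b (obs X n \<omega>) * \<rho> (Suc n) (T (Suc n) \<omega>)) \<partial>M) =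
      (\<integral>\<^sup>+\<omega>. ennreal (b (obs X n \<omega>)) * K (T n \<omega>) \<partial>M)"
    if [measurable]: "b \<in> borel_measurable (hist n)" and b0: "\<And>x. x \<in> space (hist n) \<Longrightarrow> 0 \<le> b x" for b
  proof -
    let ?F = "\<lambda>(x, y). ennreal (b x) * ennreal (\<rho> (Suc n) (\<xi> (stat t0 \<xi> n x) y))"
    have F: "?F \<in> borel_measurable (hist n \<Otimes>\<^sub>M \<mu>)" by measurable
    have "(\<integral>\<^sup>+\<omega>. ennreal (b (obs X n \<omega>) * \<rho> (Suc n) (T (Suc n) \<omega>)) \<partial>M) =
        (\<integral>\<^sup>+\<omega>. ?F (obs X n \<omega>, X (Suc n) \<omega>) \<partial>M)"
      using b0 r0 obs_space T_space[of _ "Suc n"]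
      by (intro nn_integral_cong) (simp add: ennreal_mult T_Suc del: stat.simps)
    also have "\<dots> = (\<integral>\<^sup>+\<omega>. \<integral>\<^sup>+y. ennreal (pX_t n (T n \<omega>) y) * ?F (obs X n \<omega>, y) \<partial>\<mu> \<partial>M)"
      by (rule next_obs_cond_density[OF F])
    also have "\<dots> = (\<integral>\<^sup>+\<omega>. ennreal (b (obs X n \<omega>)) * K (T n \<omega>) \<partial>M)"
    proof (intro nn_integral_cong)
      fix \<omega> assume "\<omega> \<in> space M"
      from T_space[OF this] have [measurable]: "T n \<omega> \<in> space St" .
      show "(\<integral>\<^sup>+y. ennreal (pX_t n (T n \<omega>) y) * ?F (obs X n \<omega>, y) \<partial>\<mu>) =
          ennreal (b (obs X n \<omega>)) * K (T n \<omega>)"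
        unfolding K_def
        by (subst nn_integral_cmult[symmetric]) (auto intro!: nn_integral_cong simp: mult_ac)
    qed
    finally show ?thesis .
  qed
  have fin: "(\<integral>\<^sup>+\<omega>. ennreal (\<rho> (Suc n) (T (Suc n) \<omega>)) \<partial>M) < \<infinity>"
    using value_integrable[of "Suc n"] n by (simp add: real_integrable_def less_top)
  \<comment> \<open>The weight 1 turns the finite mean of the next value into a finite mean of
    \<open>K\<close>, which makes \<open>K\<close> finite almost surely.\<close>
  then have "(\<integral>\<^sup>+\<omega>. K (T n \<omega>) \<partial>M) \<noteq> \<infinity>"
    using step[of "\<lambda>_. 1"] by simp
  then have "AE \<omega> in M. K (T n \<omega>) \<noteq> \<infinity>"
    by (intro nn_integral_noteq_infinite) auto
  then have K: "AE \<omega> in M. K (T n \<omega>) = ennreal (d n (T n \<omega>) - 1) \<and> 0 \<le> d n (T n \<omega>) - 1"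
    using AE_space
  proof eventually_elim
    case (elim \<omega>)
    note t[measurable] = T_space[OF elim(2)]
    let ?f = "\<lambda>y. \<rho> (Suc n) (\<xi> (T n \<omega>) y) * pX_t n (T n \<omega>) y"
    have f0: "0 \<le> ?f y" if "y \<in> space \<mu>" for y
      using r0 \<xi>_space[OF t that] pX_t_nonneg[OF t that] by simp
    have e: "K (T n \<omega>) = (\<integral>\<^sup>+y. ennreal (?f y) \<partial>\<mu>)"
      unfolding K_def using r0 \<xi>_space[OF t] pX_t_nonneg[OF t]
      by (intro nn_integral_cong) (simp add: ennreal_mult mult.commute)
    have "integrable \<mu> ?f"
      using elim(1) f0 unfolding e by (intro integrableI_nonneg) (auto simp: less_top)
    then have "K (T n \<omega>) = ennreal (\<integral>y. ?f y \<partial>\<mu>)"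
      unfolding e using f0 by (intro nn_integral_eq_integral) auto
    moreover have "0 \<le> (\<integral>y. ?f y \<partial>\<mu>)"
      using f0 by (intro Bochner_Integration.integral_nonneg) auto
    ultimately show ?case by (simp add: continuation_cost_def)
  qed
  have ar: "integrable M (\<lambda>\<omega>. a (obs X n \<omega>) * \<rho> (Suc n) (T (Suc n) \<omega>))"
    using n a01 obs_space by (intro integrable_mult_unit_interval value_integrable) auto
  have ar0: "AE \<omega> in M. 0 \<le> a (obs X n \<omega>) * \<rho> (Suc n) (T (Suc n) \<omega>)"
    using a01 obs_space r0 T_space[of _ "Suc n"] by (intro AE_I2 mult_nonneg_nonneg) auto
  show ?thesis
  proof (rule has_bochner_integral_nn_integral)
    show "(\<lambda>\<omega>. a (obs X n \<omega>) * (d n (T n \<omega>) - 1)) \<in> borel_measurable M"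
      unfolding continuation_cost_def by measurable
    show "AE \<omega> in M. 0 \<le> a (obs X n \<omega>) * (d n (T n \<omega>) - 1)"
      using K AE_space by eventually_elim (use a01 obs_space in auto)
    show "0 \<le> (\<integral>\<omega>. a (obs X n \<omega>) * \<rho> (Suc n) (T (Suc n) \<omega>) \<partial>M)"
      using ar0 by (rule integral_nonneg_AE)
    have "(\<integral>\<^sup>+\<omega>. ennreal (a (obs X n \<omega>) * (d n (T n \<omega>) - 1)) \<partial>M) =
        (\<integral>\<^sup>+\<omega>. ennreal (a (obs X n \<omega>)) * K (T n \<omega>) \<partial>M)"
      using K AE_space
      by (intro nn_integral_cong_AE, eventually_elim) (use a01 obs_space in \<open>auto simp: ennreal_mult\<close>)
    also have "\<dots> = (\<integral>\<^sup>+\<omega>. ennreal (a (obs X n \<omega>) * \<rho> (Suc n) (T (Suc n) \<omega>)) \<partial>M)"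
      using a01 by (intro step[symmetric]) auto
    also have "\<dots> = ennreal (\<integral>\<omega>. a (obs X n \<omega>) * \<rho> (Suc n) (T (Suc n) \<omega>) \<partial>M)"
      using ar ar0 by (rule nn_integral_eq_integral)
    finally show "(\<integral>\<^sup>+\<omega>. ennreal (a (obs X n \<omega>) * (d n (T n \<omega>) - 1)) \<partial>M) = \<dots>" .
  qed
qed

text \<open>Whether the rule goes on after time \<open>n\<close> is decided by the first
  \<open>n\<close> observations. The weight \<open>?a\<close> expresses this on
  \<open>hist n\<close>, recovering the earlier histories by restriction, so
  \<open>continuation_step\<close> applies.\<close>

lemma surviving_continuation:
  assumes \<Psi>: "stopping_rule \<mu> N \<Psi>" and n: "n < N"
  shows "has_bochner_integral M (\<lambda>\<omega>. surviving \<Psi> (Suc n) \<omega> * (d n (T n \<omega>) - 1))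
    (\<integral>\<omega>. surviving \<Psi> (Suc n) \<omega> * \<rho> (Suc n) (T (Suc n) \<omega>) \<partial>M)"
proof -
  let ?a = "\<lambda>x. \<Prod>i<Suc n. 1 - real (\<Psi> i (restrict x {1..i}))"
  have r: "(\<lambda>x. restrict x {1..i}) \<in> measurable (hist n) (hist i)" if "i \<le> n" for i
    using that by (intro measurable_restrict_subset) auto
  have s: "?a (obs X n \<omega>) = surviving \<Psi> (Suc n) \<omega>" for \<omega>
    by (intro prod.cong) (simp_all flip: obs_restrict)
  have a01: "0 \<le> ?a x \<and> ?a x \<le> 1" if x: "x \<in> space (hist n)" for x
  proof -
    have "0 \<le> 1 - real (\<Psi> i (restrict x {1..i})) \<and> 1 - real (\<Psi> i (restrict x {1..i})) \<le> 1"
      if "i < Suc n" for i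
    proof -
      have "i \<le> n" "i \<le> N" using that n by auto
      from rule_cases[OF \<Psi> this(2) measurable_space[OF r[OF this(1)] x]] show ?thesis
        by cases simp_all
    qed
    then show ?thesis by (intro conjI prod_nonneg prod_le_1) auto
  qed
  have "?a \<in> borel_measurable (hist n)"
  proof (rule borel_measurable_prod)
    fix i assume i: "i \<in> {..<Suc n}"
    then have "i \<le> N" "i \<le> n" using n by auto
    from measurable_compose[OF r[OF this(2)] rule_measurable[OF \<Psi> this(1)]]
    show "(\<lambda>x. 1 - real (\<Psi> i (restrict x {1..i}))) \<in> borel_measurable (hist n)" by simp
  qed
  from continuation_step[OF n this a01]
  show ?thesis unfolding s .
qed

section \<open>Decomposition of the cost into regrets\<close>

text \<open>The excess of the action taken at time \<open>n\<close> over the minimum in the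
  functional equation. It is kept as a function on paths so that a vanishing mean can be turned into
  almost sure optimality of the action.\<close>

definition regret :: "(nat \<Rightarrow> (nat \<Rightarrow> 'x) \<Rightarrow> nat) \<Rightarrow> nat \<Rightarrow> 'w \<Rightarrow> real" where
  "regret \<Psi> n \<omega> = stop_at X \<Psi> n \<omega> * (g n (T n \<omega>) - \<rho> n (T n \<omega>)) +
    surviving \<Psi> (Suc n) \<omega> * (d n (T n \<omega>) - \<rho> n (T n \<omega>))"

text \<open>The surviving paths at time \<open>n\<close> split into those that stop and those that go on.\<close>

lemma regret_integral:
  assumes \<Psi>: "stopping_rule \<mu> N \<Psi>" and n: "n < N"
  shows "integrable M (regret \<Psi> n)"
    and "(\<integral>\<omega>. stop_at X \<Psi> n \<omega> * (real n + g n (T n \<omega>)) \<partial>M) =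
      (\<integral>\<omega>. regret \<Psi> n \<omega> \<partial>M) + (\<integral>\<omega>. surviving \<Psi> n \<omega> * (real n + \<rho> n (T n \<omega>)) \<partial>M)
      - (\<integral>\<omega>. surviving \<Psi> (Suc n) \<omega> * (real (Suc n) + \<rho> (Suc n) (T (Suc n) \<omega>)) \<partial>M)"
proof -
  let ?\<phi> = "stop_at X \<Psi> n" and ?s = "surviving \<Psi> n" and ?s' = "surviving \<Psi> (Suc n)"
  let ?r = "\<lambda>\<omega>. \<rho> n (T n \<omega>)" and ?r' = "\<lambda>\<omega>. \<rho> (Suc n) (T (Suc n) \<omega>)"
    and ?g = "\<lambda>\<omega>. g n (T n \<omega>)" and ?d = "\<lambda>\<omega>. d n (T n \<omega>)"
  have unit: "integrable M (\<lambda>\<omega>. ?\<phi> \<omega> * h \<omega>)" "integrable M (\<lambda>\<omega>. ?s \<omega> * h \<omega>)"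
    "integrable M (\<lambda>\<omega>. ?s' \<omega> * h \<omega>)" if "integrable M h" for h
  proof -
    have le: "n \<le> N" "n \<le> Suc N" "Suc n \<le> Suc N" using n by auto
    show "integrable M (\<lambda>\<omega>. ?\<phi> \<omega> * h \<omega>)"
      using that stop_at_measurable[OF \<Psi> le(1)]
      by (rule integrable_mult_unit_interval) (simp add: stop_at_eq[OF \<Psi> le(1)])
    show "integrable M (\<lambda>\<omega>. ?s \<omega> * h \<omega>)"
      using that surviving_measurable[OF \<Psi> le(2)]
      by (rule integrable_mult_unit_interval) (simp add: surviving_eq[OF \<Psi> le(2)])
    show "integrable M (\<lambda>\<omega>. ?s' \<omega> * h \<omega>)"
      using that surviving_measurable[OF \<Psi> le(3)]
      by (rule integrable_mult_unit_interval) (simp only: surviving_eq[OF \<Psi> le(3)], simp)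
  qed
  have ir: "integrable M ?r" and ir': "integrable M ?r'" and ig: "integrable M ?g"
    using n by (auto intro!: value_integrable g_integrable simp del: stat.simps)
  have isd: "integrable M (\<lambda>\<omega>. ?s' \<omega> * (?d \<omega> - 1))"
    and sd: "(\<integral>\<omega>. ?s' \<omega> * (?d \<omega> - 1) \<partial>M) = (\<integral>\<omega>. ?s' \<omega> * ?r' \<omega> \<partial>M)"
    using surviving_continuation[OF \<Psi> n] unfolding has_bochner_integral_iff by auto
  \<comment> \<open>Integrability is at hand for \<open>?s'\<close> times \<open>?d - 1\<close>, so
    \<open>?d - ?r\<close> is split into \<open>?d - 1\<close> and \<open>1 - ?r\<close>.\<close>
  have R: "regret \<Psi> n = (\<lambda>\<omega>. ?\<phi> \<omega> * (?g \<omega> - ?r \<omega>) + (?s' \<omega> * (?d \<omega> - 1) + ?s' \<omega> * (1 - ?r \<omega>)))"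
    by (simp add: regret_def[abs_def] algebra_simps del: prod.lessThan_Suc)
  show iR: "integrable M (regret \<Psi> n)"
    unfolding R by (intro Bochner_Integration.integrable_add isd unit Bochner_Integration.integrable_diff ig ir) auto
  have i1: "integrable M (\<lambda>\<omega>. ?s \<omega> * (real n + ?r \<omega>))" "integrable M (\<lambda>\<omega>. ?s' \<omega> * real (Suc n))"
    by (rule unit, use ir in simp)+
  \<comment> \<open>The identity \<open>stop_at_surviving\<close> combined with
    \<open>n + ?d = Suc n + (?d - 1)\<close>: the summand 1 in \<open>?d\<close> pays for the next
    observation, and \<open>sd\<close> turns the rest into the next value.\<close>
  have "?\<phi> \<omega> * (real n + ?g \<omega>) = regret \<Psi> n \<omega> + ?s \<omega> * (real n + ?r \<omega>) -
      (?s' \<omega> * real (Suc n) + ?s' \<omega> * (?d \<omega> - 1))" for \<omega>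
    by (simp add: regret_def stop_at_surviving algebra_simps del: prod.lessThan_Suc)
  then have "(\<integral>\<omega>. ?\<phi> \<omega> * (real n + ?g \<omega>) \<partial>M) = (\<integral>\<omega>. regret \<Psi> n \<omega> \<partial>M) +
      (\<integral>\<omega>. ?s \<omega> * (real n + ?r \<omega>) \<partial>M) -
      ((\<integral>\<omega>. ?s' \<omega> * real (Suc n) \<partial>M) + (\<integral>\<omega>. ?s' \<omega> * (?d \<omega> - 1) \<partial>M))"
    using iR i1 isd by (simp del: prod.lessThan_Suc of_nat_Suc integral_mult_left_zero integral_mult_left)
  also have "(\<integral>\<omega>. ?s' \<omega> * real (Suc n) \<partial>M) + (\<integral>\<omega>. ?s' \<omega> * (?d \<omega> - 1) \<partial>M) =
      (\<integral>\<omega>. ?s' \<omega> * real (Suc n) + ?s' \<omega> * ?r' \<omega> \<partial>M)"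
    unfolding sd by (rule Bochner_Integration.integral_add[symmetric]) (intro i1 unit ir')+
  finally show "(\<integral>\<omega>. ?\<phi> \<omega> * (real n + ?g \<omega>) \<partial>M) = (\<integral>\<omega>. regret \<Psi> n \<omega> \<partial>M) +
      (\<integral>\<omega>. ?s \<omega> * (real n + ?r \<omega>) \<partial>M) - (\<integral>\<omega>. ?s' \<omega> * (real (Suc n) + ?r' \<omega>) \<partial>M)"
    by (simp only: distrib_left)
qed

text \<open>With \<open>E n\<close> the mean of elapsed time plus value on the paths that reach time
  \<open>n\<close>, the costs before the horizon telescope to the regrets plus
  \<open>E 0 - E N\<close>. At the horizon every remaining path stops and
  \<open>\<rho> N = g N\<close>, so the last cost is \<open>E N\<close> and cancels. At time 0 every
  path survives and the statistic is \<open>t0\<close>.\<close>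

lemma objective_eq:
  assumes \<Psi>: "stopping_rule \<mu> N \<Psi>"
  shows "stopping_objective M X t0 \<xi> g N \<Psi> = \<rho> 0 t0 + (\<Sum>n<N. \<integral>\<omega>. regret \<Psi> n \<omega> \<partial>M)"
proof -
  define E where "E n = (\<integral>\<omega>. surviving \<Psi> n \<omega> * (real n + \<rho> n (T n \<omega>)) \<partial>M)" for n
  let ?c = "\<lambda>n. \<integral>\<omega>. stop_at X \<Psi> n \<omega> * (real n + g n (T n \<omega>)) \<partial>M"
  have "(\<Sum>n<m. ?c n) = (\<Sum>n<m. \<integral>\<omega>. regret \<Psi> n \<omega> \<partial>M) + E 0 - E m" if "m \<le> N" for m
    using that
  proof (induction m)
    case (Suc m)
    then show ?case using regret_integral(2)[OF \<Psi>, of m] by (simp add: E_def)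
  qed simp
  moreover have "?c N = E N"
    unfolding E_def
  proof (rule Bochner_Integration.integral_cong)
    fix \<omega> assume \<omega>: "\<omega> \<in> space M"
    then have "\<Psi> N (obs X N \<omega>) = 1"
      using \<Psi> obs_space by (auto simp: stopping_rule_def)
    then show "stop_at X \<Psi> N \<omega> * (real N + g N (T N \<omega>)) =
        surviving \<Psi> N \<omega> * (real N + \<rho> N (T N \<omega>))"
      using value_horizon T_space[OF \<omega>] by (simp add: stop_at_def)
  qed simp
  moreover have "E 0 = \<rho> 0 t0" by (simp add: E_def prob_space)
  ultimately show ?thesis
    by (simp add: stopping_objective_def lessThan_Suc_atMost[symmetric])
qed

lemma regret_cases:
  assumes \<Psi>: "stopping_rule \<mu> N \<Psi>" and n: "n < N" and \<omega>: "\<omega> \<in> space M"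
  obtains "\<exists>i<n. \<Psi> i (obs X i \<omega>) \<noteq> 0" "regret \<Psi> n \<omega> = 0"
  | "\<forall>i<n. \<Psi> i (obs X i \<omega>) = 0" "\<Psi> n (obs X n \<omega>) = 1" "regret \<Psi> n \<omega> = g n (T n \<omega>) - \<rho> n (T n \<omega>)"
  | "\<forall>i<n. \<Psi> i (obs X i \<omega>) = 0" "\<Psi> n (obs X n \<omega>) = 0" "regret \<Psi> n \<omega> = d n (T n \<omega>) - \<rho> n (T n \<omega>)"
proof -
  have le: "n \<le> N" "n \<le> Suc N" using n by auto
  have R: "regret \<Psi> n \<omega> = surviving \<Psi> n \<omega> * (real (\<Psi> n (obs X n \<omega>)) * (g n (T n \<omega>) - \<rho> n (T n \<omega>)) +
      (1 - real (\<Psi> n (obs X n \<omega>))) * (d n (T n \<omega>) - \<rho> n (T n \<omega>)))"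
    by (simp add: regret_def stop_at_def algebra_simps)
  show ?thesis
  proof (cases "\<forall>i<n. \<Psi> i (obs X i \<omega>) = 0")
    case True
    have R': "regret \<Psi> n \<omega> = real (\<Psi> n (obs X n \<omega>)) * (g n (T n \<omega>) - \<rho> n (T n \<omega>)) +
        (1 - real (\<Psi> n (obs X n \<omega>))) * (d n (T n \<omega>) - \<rho> n (T n \<omega>))"
      unfolding R surviving_eq[OF \<Psi> le(2) \<omega>] if_P[OF True] by (rule mult_1_left)
    from rule_cases[OF \<Psi> le(1) obs_space[OF \<omega>]] show ?thesis
    proof cases
      case 1
      with R' have "regret \<Psi> n \<omega> = d n (T n \<omega>) - \<rho> n (T n \<omega>)" by (simp only:) simp
      with True 1 show ?thesis by (rule that(3))
    next
      case 2
      with R' have "regret \<Psi> n \<omega> = g n (T n \<omega>) - \<rho> n (T n \<omega>)" by (simp only:) simp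
      with True 2 show ?thesis by (rule that(2))
    qed
  next
    case False
    have "regret \<Psi> n \<omega> = 0"
      unfolding R surviving_eq[OF \<Psi> le(2) \<omega>] if_not_P[OF False] by (rule mult_zero_left)
    with False show ?thesis by (intro that(1)) auto
  qed
qed

lemma regret_nonneg:
  assumes "stopping_rule \<mu> N \<Psi>" "n < N" "\<omega> \<in> space M"
  shows "0 \<le> regret \<Psi> n \<omega>"
  using regret_cases[OF assms] value_eq[OF assms(2) T_space[OF assms(3)]] by cases simp_all

lemma regret_eq_0_iff:
  assumes "stopping_rule \<mu> N \<Psi>" "n < N" "\<omega> \<in> space M"
  shows "regret \<Psi> n \<omega> = 0 \<longleftrightarrow>
    ((\<forall>i<n. \<Psi> i (obs X i \<omega>) = 0) \<longrightarrow>
      (\<Psi> n (obs X n \<omega>) = 1 \<longrightarrow> \<rho> n (T n \<omega>) = g n (T n \<omega>)) \<and>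
      (\<Psi> n (obs X n \<omega>) = 0 \<longrightarrow> \<rho> n (T n \<omega>) = d n (T n \<omega>)))"
  using regret_cases[OF assms]
proof cases
  case 1
  then have "\<not> (\<forall>i<n. \<Psi> i (obs X i \<omega>) = 0)" by simp
  then show ?thesis by (simp only: 1(2) simp_thms)
next
  case 2
  have e: "regret \<Psi> n \<omega> = 0 \<longleftrightarrow> \<rho> n (T n \<omega>) = g n (T n \<omega>)" unfolding 2(3) by linarith
  show ?thesis by (simp only: e eqTrueI[OF 2(1)] 2(2) one_neq_zero simp_thms)
next
  case 3
  have e: "regret \<Psi> n \<omega> = 0 \<longleftrightarrow> \<rho> n (T n \<omega>) = d n (T n \<omega>)" unfolding 3(3) by linarith
  show ?thesis by (simp only: e eqTrueI[OF 3(1)] 3(2) zero_neq_one simp_thms)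
qed

lemma objective_ge:
  assumes "stopping_rule \<mu> N \<Psi>"
  shows "\<rho> 0 t0 \<le> stopping_objective M X t0 \<xi> g N \<Psi>"
  unfolding objective_eq[OF assms] using regret_nonneg[OF assms]
  by (auto intro!: sum_nonneg Bochner_Integration.integral_nonneg)

text \<open>A finite sum of integrals of nonnegative regrets vanishes exactly if each regret
  vanishes almost surely. There are finitely many times, so one null set serves them all.\<close>

lemma objective_eq_value_iff:
  assumes \<Psi>: "stopping_rule \<mu> N \<Psi>"
  shows "stopping_objective M X t0 \<xi> g N \<Psi> = \<rho> 0 t0 \<longleftrightarrow>
    follows_equations M \<mu> X t0 \<xi> pX_t g N \<rho> \<Psi>"
proof -
  have "stopping_objective M X t0 \<xi> g N \<Psi> = \<rho> 0 t0 \<longleftrightarrow> (\<Sum>n<N. \<integral>\<omega>. regret \<Psi> n \<omega> \<partial>M) = 0"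
    by (simp add: objective_eq[OF \<Psi>])
  also have "\<dots> \<longleftrightarrow> (\<forall>n<N. (\<integral>\<omega>. regret \<Psi> n \<omega> \<partial>M) = 0)"
    using regret_nonneg[OF \<Psi>]
    by (subst sum_nonneg_eq_0_iff) (auto intro!: Bochner_Integration.integral_nonneg)
  also have "\<dots> \<longleftrightarrow> (\<forall>n<N. AE \<omega> in M. regret \<Psi> n \<omega> = 0)"
    using integral_nonneg_eq_0_iff_AE[OF regret_integral(1)[OF \<Psi>]] regret_nonneg[OF \<Psi>] by auto
  also have "\<dots> \<longleftrightarrow> (AE \<omega> in M. \<forall>n<N. regret \<Psi> n \<omega> = 0)"
    using AE_ball_countable[where X = "{..<N}" and M = M and P = "\<lambda>\<omega> n. regret \<Psi> n \<omega> = 0"]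
    by (simp add: Ball_def)
  also have "\<dots> \<longleftrightarrow> follows_equations M \<mu> X t0 \<xi> pX_t g N \<rho> \<Psi>"
    unfolding follows_equations_def Let_def
    by (rule AE_cong) (simp add: regret_eq_0_iff[OF \<Psi>])
  finally show ?thesis .
qed

section \<open>The threshold rule\<close>

lemma threshold_stopping_rule: "stopping_rule \<mu> N (threshold_rule t0 \<xi> g \<rho>)"
proof -
  have "threshold_rule t0 \<xi> g \<rho> n \<in> measurable (hist n) (count_space {0, 1})" if "n \<le> N" for n
  proof -
    note value_measurable[OF that, measurable]
    have [measurable]: "stat t0 \<xi> n \<in> measurable (hist n) St" by simp
    show ?thesis unfolding threshold_rule_def[abs_def] by measurable
  qed
  then show ?thesis
    using value_horizon measurable_space[OF stat_measurable[of N N]]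
    by (auto simp: stopping_rule_def threshold_rule_def)
qed

text \<open>Where the rule goes on, \<open>\<rho>\<close> differs from the stopping cost, so the
  minimum must be attained by continuing. Ties are resolved by stopping.\<close>

lemma threshold_follows_equations:
  "follows_equations M \<mu> X t0 \<xi> pX_t g N \<rho> (threshold_rule t0 \<xi> g \<rho>)"
  unfolding follows_equations_def Let_def
  using value_eq T_space by (intro AE_I2) (auto simp: threshold_rule_def min_def split: if_splits)

end

end

section \<open>Existence of a solution and the characterization of optimal rules\<close>

text \<open>The equations run backward in time, so the solution is built by recursion on the number
  \<open>k\<close> of steps left: \<open>r k\<close> is the value at time \<open>N - k\<close>, and
  passing from \<open>k\<close> to \<open>Suc k\<close> uses the data of time
  \<open>N - Suc k\<close>.\<close>

lemma functional_equations_solvable: "\<exists>\<rho>. functional_equations \<mu> St \<xi> pX_t g N \<rho>"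
proof -
  define r where "r = rec_nat (g N) (\<lambda>k h t. min (g (N - Suc k) t)
    (1 + (\<integral>x. h (\<xi> t x) * pX_t (N - Suc k) t x \<partial>\<mu>)))"
  have r_0: "r 0 = g N" and r_Suc: "r (Suc k) t =
      min (g (N - Suc k) t) (1 + (\<integral>x. r k (\<xi> t x) * pX_t (N - Suc k) t x \<partial>\<mu>))" for k t
    by (simp_all add: r_def)
  have "functional_equations \<mu> St \<xi> pX_t g N (\<lambda>n. r (N - n))"
    unfolding functional_equations_def continuation_cost_def
  proof (intro conjI allI impI ballI)
    fix n t assume n: "n < N"
    define k where "k = N - Suc n"
    have "N - n = Suc k" "n = N - Suc k" using n by (auto simp: k_def)
    then show "r (N - n) t = min (g n t) (1 + (\<integral>x. r (N - Suc n) (\<xi> t x) * pX_t n t x \<partial>\<mu>))"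
      using r_Suc[of k t] unfolding k_def[symmetric] by metis
  qed (simp add: r_0)
  then show ?thesis by (rule exI[where x = "\<lambda>n. r (N - n)"])
qed

theorem theorem3p1:
  fixes M :: "'w measure" and \<mu> :: "'x measure" and St :: "'t measure"
    and N :: nat and C :: "nat \<Rightarrow> real" and g :: "nat \<Rightarrow> 't \<Rightarrow> real"
    and J :: "(nat \<Rightarrow> (nat \<Rightarrow> 'x) \<Rightarrow> nat) \<Rightarrow> real"
  assumes model: "joint_detection_estimation M \<mu> H \<Theta> X p\<^sub>H p\<^sub>\<Theta> p\<^sub>X St t0 \<xi> pH_t p\<Theta>_t p\<Theta>_Ht pX_t"
    and N: "1 \<le> N"
    and weights: "\<forall>i\<le>3. 0 \<le> C i"
    and g: "g = stop_cost C pH_t p\<Theta>_Ht"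
    and J: "J = stopping_objective M X t0 \<xi> g N"
  shows "(\<exists>\<rho>. functional_equations \<mu> St \<xi> pX_t g N \<rho>) \<and>
    (\<forall>\<rho>. functional_equations \<mu> St \<xi> pX_t g N \<rho> \<longrightarrow>
       is_arg_min J (stopping_rule \<mu> N) (threshold_rule t0 \<xi> g \<rho>) \<and>
       J (threshold_rule t0 \<xi> g \<rho>) = \<rho> 0 t0 \<and>
       (\<forall>\<Psi>. stopping_rule \<mu> N \<Psi> \<longrightarrow>
          (is_arg_min J (stopping_rule \<mu> N) \<Psi> \<longleftrightarrow>
           follows_equations M \<mu> X t0 \<xi> pX_t g N \<rho> \<Psi>)))"
proof (intro conjI functional_equations_solvable allI impI)
  interpret joint_detection_estimation M \<mu> H \<Theta> X p\<^sub>H p\<^sub>\<Theta> p\<^sub>X St t0 \<xi> pH_t p\<Theta>_t p\<Theta>_Ht pX_t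
    by (fact model)
  fix \<rho> assume eq: "functional_equations \<mu> St \<xi> pX_t g N \<rho>"
  note g_facts = stop_cost_properties[OF weights, folded g]
  note thr = threshold_stopping_rule[OF g_facts eq]
  have ge: "\<rho> 0 t0 \<le> J \<Psi>" if "stopping_rule \<mu> N \<Psi>" for \<Psi>
    using objective_ge[OF g_facts eq that] by (simp add: J)
  have iff: "J \<Psi> = \<rho> 0 t0 \<longleftrightarrow> follows_equations M \<mu> X t0 \<xi> pX_t g N \<rho> \<Psi>"
    if "stopping_rule \<mu> N \<Psi>" for \<Psi>
    using objective_eq_value_iff[OF g_facts eq that] by (simp add: J)
  show val: "J (threshold_rule t0 \<xi> g \<rho>) = \<rho> 0 t0"
    using iff[OF thr] threshold_follows_equations[OF g_facts eq] by simp
  show "is_arg_min J (stopping_rule \<mu> N) (threshold_rule t0 \<xi> g \<rho>)"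
    unfolding is_arg_min_linorder val using thr ge by blast
  fix \<Psi> assume \<Psi>: "stopping_rule \<mu> N \<Psi>"
  \<comment> \<open>The value \<open>\<rho> 0 t0\<close> is a lower bound for every rule and the
    threshold rule attains it, so optimality amounts to reaching this number.\<close>
  have "is_arg_min J (stopping_rule \<mu> N) \<Psi> \<longleftrightarrow> J \<Psi> = \<rho> 0 t0"
  proof
    assume "is_arg_min J (stopping_rule \<mu> N) \<Psi>"
    then have "J \<Psi> \<le> J (threshold_rule t0 \<xi> g \<rho>)"
      using thr unfolding is_arg_min_linorder by blast
    then show "J \<Psi> = \<rho> 0 t0"
      unfolding val using ge[OF \<Psi>] by (rule order_antisym)
  next
    assume "J \<Psi> = \<rho> 0 t0"
    then show "is_arg_min J (stopping_rule \<mu> N) \<Psi>"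
      unfolding is_arg_min_linorder using \<Psi> ge by simp
  qed
  then show "is_arg_min J (stopping_rule \<mu> N) \<Psi> \<longleftrightarrow> follows_equations M \<mu> X t0 \<xi> pX_t g N \<rho> \<Psi>"
    using iff[OF \<Psi>] by simp
qed

end
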